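(* Let $\delta$ be a unimodal range map and $\mathcal{S}$ be a nonempty graded subset of $\mathsf{Cl}_\delta$. If $\mathcal{S}$ is closed by subword reduction, then $\mathcal{V}_{\mathcal{S}}$ is an operad ideal of $\mathbf{Cl}_\delta$. Therefore, in this case, $\mathbf{Cl}_{\mathcal{S}}:=\mathbf{Cl}_\delta/\mathcal{V}_{\mathcal{S}}$ is a quotient operad of $\mathbf{Cl}_\delta$.
   Context: $\mathbb{N}=\{0,1,2,\dots\}$ and $\mathbb{K}$ is a field of characteristic zero. A range map is a map $\delta:\mathbb{N}\setminus\{0\}\to\mathbb{N}$. It is unimodal if there are no $1\le i_1<i_2<i_3$ with $\delta(i_1)>\delta(i_2)<\delta(i_3)$. For a word $w$ on $\mathbb{N}$, $\ell(w)$ is its length, $w(i)$ its $i$-th letter, $\epsilon$ is the empty word. A $\delta$-cliff is a word $w$ on $\mathbb{N}$ with $0\le w(i)\le\delta(i)$ for all $i$; its size is $|w|:=\ell(w)+1$; $\mathsf{Cl}_\delta$ is the set of all $\delta$-cliffs, graded by size. The $\delta$-reduction of a word $w$ on $\mathbb{N}$ is the $\delta$-cliff $\mathrm{r}_\delta(w)$ of length $\ell(w)$ with $i$-th letter $\min\{w(i),\delta(i)\}$. For words $u,v$ and $1\le i\le|u|$, $u\,\square_i\,v:=u(1)\cdots u(i-1)\;v\;u(i)\cdots u(\ell(u))$. For $\delta$ unimodal, $\mathbf{Cl}_\delta$ is the nonsymmetric operad over $\mathbb{K}$ with basis $\{\mathsf{E}_w:w\in\mathsf{Cl}_\delta\}$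 ($\mathsf{E}_w$ of arity $|w|$), partial compositions $\mathsf{E}_u\circ_i\mathsf{E}_v=\mathsf{E}_{u\,\square_i\,v}$ if $u\,\square_i\,v\in\mathsf{Cl}_\delta$ and $\mathsf{E}_u\circ_i\mathsf{E}_v=0$ otherwise, and unit $\mathsf{E}_\epsilon$. Order: for $u,v$ of the same length, $u\preccurlyeq v$ iff $u(j)\le v(j)$ for all $j$. Fundamental basis of $\mathbf{Cl}_\delta$: $\mathsf{F}_w:=\sum_{w'\in\mathsf{Cl}_\delta,\,w\preccurlyeq w'}\mu_\preccurlyeq(w,w')\,\mathsf{E}_{w'}$, where $\mu_\preccurlyeq$ is the Möbius function of the poset $\preccurlyeq$ on $\delta$-cliffs of a given size; equivalently $\mathsf{E}_w=\sum_{w'\in\mathsf{Cl}_\delta,\,w\preccurlyeq w'}\mathsf{F}_{w'}$. A nonempty graded subset $\mathcal{S}\subseteq\mathsf{Cl}_\delta$ is closed by subword reduction if for any $w\in\mathcal{S}$ and any subword $w'$ of $w$ (a subsequence of not necessarily contiguous letters of $w$, possibly empty), $\mathrm{r}_\delta(w')\in\mathcal{S}$. $\mathcal{V}_{\mathcal{S}}$ is the linear span of $\{\mathsf{F}_w:w\in\mathsf{Cl}_\delta\setminus\mathcal{S}\}$. *)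

theory Defs
  imports "HOL-Algebra.Algebra" "HOL-Library.Sublist"
begin

section \<open>Linear algebra with explicit carriers\<close>

definition lin_span ::
  "('k, 'a) ring_scheme \<Rightarrow> ('k, 'v, 'b) module_scheme \<Rightarrow> 'v set \<Rightarrow> 'v set" where
  "lin_span K M B =
     {finsum M (\<lambda>x. a x \<odot>\<^bsub>M\<^esub> x) A | a A. finite A \<and> A \<subseteq> B \<and> a \<in> A \<rightarrow> carrier K}"

definition linear_map ::
  "('k, 'a) ring_scheme \<Rightarrow> ('k, 'v, 'b) module_scheme \<Rightarrow> ('k, 'w, 'c) module_scheme
     \<Rightarrow> ('v \<Rightarrow> 'w) \<Rightarrow> bool" where
  "linear_map K M N f \<longleftrightarrow>
     f \<in> hom (add_monoid M) (add_monoid N) \<and>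
     (\<forall>r\<in>carrier K. \<forall>x\<in>carrier M. f (r \<odot>\<^bsub>M\<^esub> x) = r \<odot>\<^bsub>N\<^esub> f x)"

text \<open>The module record extends the ring record; its multiplicative fields play no role in the
  locale \<^locale>\<open>module\<close> and are left undefined in the modules built below.\<close>

definition quotient_module :: "('k, 'v, 'b) module_scheme \<Rightarrow> 'v set \<Rightarrow> ('k, 'v set) module" where
  "quotient_module M H =
     \<lparr>carrier = a_rcosets\<^bsub>M\<^esub> H, monoid.mult = undefined, monoid.one = undefined,
      ring.zero = H, ring.add = set_add M,
      module.smult = (\<lambda>r B. \<Union>x\<in>B. H +>\<^bsub>M\<^esub> (r \<odot>\<^bsub>M\<^esub> x))\<rparr>"


section \<open>Nonsymmetric operads\<close>

text \<open>In \<open>pcomp P n m i x y\<close>, the naturals \<open>n\<close> and \<open>m\<close> are the arities of \<open>x\<close> and \<open>y\<close>; the value is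
  meaningful for \<open>1 \<le> i \<le> n\<close> only. Under this condition the truncated subtraction in
  \<open>n + m - 1\<close> is harmless.\<close>

record ('k, 'v) operad_data =
  component :: "nat \<Rightarrow> ('k, 'v) module"
  pcomp :: "nat \<Rightarrow> nat \<Rightarrow> nat \<Rightarrow> 'v \<Rightarrow> 'v \<Rightarrow> 'v"
  ounit :: 'v

locale ns_operad = K?: field K
  for K :: "('k, 'a) ring_scheme" (structure) and P :: "('k, 'v) operad_data" +
  assumes component_module: "module K (component P n)"
    and ounit_closed: "ounit P \<in> carrier (component P 1)"
    and pcomp_linear_left:
      "\<lbrakk>1 \<le> i; i \<le> n; y \<in> carrier (component P m)\<rbrakk>
        \<Longrightarrow> linear_map K (component P n) (component P (n + m - 1)) (\<lambda>x. pcomp P n m i x y)"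
    and pcomp_linear_right:
      "\<lbrakk>1 \<le> i; i \<le> n; x \<in> carrier (component P n)\<rbrakk>
        \<Longrightarrow> linear_map K (component P m) (component P (n + m - 1)) (\<lambda>y. pcomp P n m i x y)"
    and pcomp_sequential:
      "\<lbrakk>1 \<le> i; i \<le> n; 1 \<le> j; j \<le> m; x \<in> carrier (component P n);
        y \<in> carrier (component P m); z \<in> carrier (component P l)\<rbrakk>
        \<Longrightarrow> pcomp P (n + m - 1) l (i + j - 1) (pcomp P n m i x y) z
          = pcomp P n (m + l - 1) i x (pcomp P m l j y z)"
    and pcomp_parallel:
      "\<lbrakk>1 \<le> i; i < j; j \<le> n; x \<in> carrier (component P n);
        y \<in> carrier (component P m); z \<in> carrier (component P l)\<rbrakk>
        \<Longrightarrow> pcomp P (n + m - 1) l (j + m - 1) (pcomp P n m i x y) z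
          = pcomp P (n + l - 1) m i (pcomp P n l j x z) y"
    and ounit_left: "x \<in> carrier (component P n) \<Longrightarrow> pcomp P 1 n 1 (ounit P) x = x"
    and ounit_right:
      "\<lbrakk>1 \<le> i; i \<le> n; x \<in> carrier (component P n)\<rbrakk> \<Longrightarrow> pcomp P n 1 i x (ounit P) = x"

locale operad_ideal = ns_operad K P
  for K :: "('k, 'a) ring_scheme" (structure) and P :: "('k, 'v) operad_data"
    and I :: "nat \<Rightarrow> 'v set" +
  assumes ideal_submodule: "submodule (I n) K (component P n)"
    and ideal_left:
      "\<lbrakk>1 \<le> i; i \<le> n; x \<in> I n; y \<in> carrier (component P m)\<rbrakk>
        \<Longrightarrow> pcomp P n m i x y \<in> I (n + m - 1)"
    and ideal_right:
      "\<lbrakk>1 \<le> i; i \<le> n; x \<in> carrier (component P n); y \<in> I m\<rbrakk>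
        \<Longrightarrow> pcomp P n m i x y \<in> I (n + m - 1)"

definition quotient_operad ::
  "('k, 'v) operad_data \<Rightarrow> (nat \<Rightarrow> 'v set) \<Rightarrow> ('k, 'v set) operad_data" where
  "quotient_operad P I =
     \<lparr>component = (\<lambda>n. quotient_module (component P n) (I n)),
      pcomp = (\<lambda>n m i B C. \<Union>x\<in>B. \<Union>y\<in>C.
                 I (n + m - 1) +>\<^bsub>component P (n + m - 1)\<^esub> pcomp P n m i x y),
      ounit = I 1 +>\<^bsub>component P 1\<^esub> ounit P\<rparr>"

locale operad_hom = P?: ns_operad K P + Q?: ns_operad K Q
  for K :: "('k, 'a) ring_scheme" (structure) and P :: "('k, 'v) operad_data"
    and Q :: "('k, 'w) operad_data" and h :: "nat \<Rightarrow> 'v \<Rightarrow> 'w" +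
  assumes hom_linear: "linear_map K (component P n) (component Q n) (h n)"
    and hom_pcomp:
      "\<lbrakk>1 \<le> i; i \<le> n; x \<in> carrier (component P n); y \<in> carrier (component P m)\<rbrakk>
        \<Longrightarrow> h (n + m - 1) (pcomp P n m i x y) = pcomp Q n m i (h n x) (h m y)"
    and hom_ounit: "h 1 (ounit P) = ounit Q"


section \<open>Cliffs\<close>

text \<open>Range maps are functions on all of \<^typ>\<open>nat\<close> whose value at \<open>0\<close> is never used. Letters of
  words are numbered from \<open>1\<close>, so that the \<open>i\<close>-th letter of \<open>w\<close> is \<open>w ! (i - 1)\<close>.\<close>

definition unimodal :: "(nat \<Rightarrow> nat) \<Rightarrow> bool" where
  "unimodal \<delta> \<longleftrightarrow>
     \<not> (\<exists>i1 i2 i3. 1 \<le> i1 \<and> i1 < i2 \<and> i2 < i3 \<and> \<delta> i1 > \<delta> i2 \<and> \<delta> i2 < \<delta> i3)"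

definition cliffs :: "(nat \<Rightarrow> nat) \<Rightarrow> nat list set" where
  "cliffs \<delta> = {w. \<forall>i\<in>{1..length w}. w ! (i - 1) \<le> \<delta> i}"

definition wsize :: "nat list \<Rightarrow> nat" where
  "wsize w = length w + 1"

definition cliffs_of_size :: "(nat \<Rightarrow> nat) \<Rightarrow> nat \<Rightarrow> nat list set" where
  "cliffs_of_size \<delta> n = {w \<in> cliffs \<delta>. wsize w = n}"

definition reduction :: "(nat \<Rightarrow> nat) \<Rightarrow> nat list \<Rightarrow> nat list" where
  "reduction \<delta> w = map (\<lambda>i. min (w ! (i - 1)) (\<delta> i)) [1..<length w + 1]"

definition insert_word :: "nat list \<Rightarrow> nat \<Rightarrow> nat list \<Rightarrow> nat list" where
  "insert_word u i v = take (i - 1) u @ v @ drop (i - 1) u"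

definition closed_by_subword_reduction :: "(nat \<Rightarrow> nat) \<Rightarrow> nat list set \<Rightarrow> bool" where
  "closed_by_subword_reduction \<delta> S \<longleftrightarrow> (\<forall>w\<in>S. \<forall>w'. subseq w' w \<longrightarrow> reduction \<delta> w' \<in> S)"

definition word_le :: "nat list \<Rightarrow> nat list \<Rightarrow> bool" (infix "\<preceq>" 50) where
  "u \<preceq> v \<longleftrightarrow> list_all2 (\<le>) u v"

lemma word_le_sum_list: "u \<preceq> v \<Longrightarrow> u \<noteq> v \<Longrightarrow> sum_list u < sum_list v"
proof -
  have "list_all2 (\<le>) u v \<Longrightarrow> sum_list u \<le> sum_list v \<and> (u \<noteq> v \<longrightarrow> sum_list u < sum_list v)"
    by (induction rule: list_all2_induct) auto
  then show "u \<preceq> v \<Longrightarrow> u \<noteq> v \<Longrightarrow> sum_list u < sum_list v"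
    by (simp add: word_le_def)
qed

text \<open>The Moebius function of the poset of cliffs; words of distinct lengths are incomparable.\<close>

function moebius :: "(nat \<Rightarrow> nat) \<Rightarrow> nat list \<Rightarrow> nat list \<Rightarrow> int" where
  "moebius \<delta> u v =
     (if u = v then 1
      else if u \<preceq> v then - (\<Sum>w\<in>{w \<in> cliffs \<delta>. u \<preceq> w \<and> w \<preceq> v \<and> w \<noteq> v}. moebius \<delta> u w)
      else 0)"
  by pat_completeness auto
termination
  by (relation "measure (\<lambda>(\<delta>, u, v). sum_list v)") (auto simp: word_le_sum_list)

declare moebius.simps [simp del]


section \<open>The operad of cliffs\<close>

text \<open>An element of arity \<open>n\<close> is given by its coordinates on the basis of the \<open>E_basis K w\<close>,
  extended by zero to all words.\<close>

definition cliff_module :: "('k, 'a) ring_scheme \<Rightarrow> (nat \<Rightarrow> nat) \<Rightarrow> nat \<Rightarrow> ('k, nat list \<Rightarrow> 'k) module"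
  where
  "cliff_module K \<delta> n =
     \<lparr>carrier = {f. (\<forall>w. f w \<in> carrier K) \<and> (\<forall>w. w \<notin> cliffs_of_size \<delta> n \<longrightarrow> f w = \<zero>\<^bsub>K\<^esub>)},
      monoid.mult = undefined, monoid.one = undefined,
      ring.zero = (\<lambda>w. \<zero>\<^bsub>K\<^esub>), ring.add = (\<lambda>f g w. f w \<oplus>\<^bsub>K\<^esub> g w),
      module.smult = (\<lambda>r f w. r \<otimes>\<^bsub>K\<^esub> f w)\<rparr>"

definition E_basis :: "('k, 'a) ring_scheme \<Rightarrow> nat list \<Rightarrow> nat list \<Rightarrow> 'k" where
  "E_basis K w = (\<lambda>w'. if w' = w then \<one>\<^bsub>K\<^esub> else \<zero>\<^bsub>K\<^esub>)"

definition E_pcomp ::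
  "('k, 'a) ring_scheme \<Rightarrow> (nat \<Rightarrow> nat) \<Rightarrow> nat \<Rightarrow> nat list \<Rightarrow> nat list \<Rightarrow> nat list \<Rightarrow> 'k" where
  "E_pcomp K \<delta> i u v =
     (if insert_word u i v \<in> cliffs \<delta> then E_basis K (insert_word u i v) else (\<lambda>w. \<zero>\<^bsub>K\<^esub>))"

definition cliff_operad ::
  "('k, 'a) ring_scheme \<Rightarrow> (nat \<Rightarrow> nat) \<Rightarrow> ('k, nat list \<Rightarrow> 'k) operad_data" where
  "cliff_operad K \<delta> =
     \<lparr>component = cliff_module K \<delta>,
      pcomp = (\<lambda>n m i f g.
        finsum (cliff_module K \<delta> (n + m - 1))
          (\<lambda>(u, v). (f u \<otimes>\<^bsub>K\<^esub> g v) \<odot>\<^bsub>cliff_module K \<delta> (n + m - 1)\<^esub> E_pcomp K \<delta> i u v)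
          (cliffs_of_size \<delta> n \<times> cliffs_of_size \<delta> m)),
      ounit = E_basis K []\<rparr>"

definition F_basis ::
  "('k, 'a) ring_scheme \<Rightarrow> (nat \<Rightarrow> nat) \<Rightarrow> nat list \<Rightarrow> nat list \<Rightarrow> 'k" where
  "F_basis K \<delta> w =
     finsum (cliff_module K \<delta> (wsize w))
       (\<lambda>w'. ([moebius \<delta> w w'] \<cdot>\<^bsub>K\<^esub> \<one>\<^bsub>K\<^esub>) \<odot>\<^bsub>cliff_module K \<delta> (wsize w)\<^esub> E_basis K w')
       {w' \<in> cliffs \<delta>. w \<preceq> w'}"

text \<open>The family of homogeneous components of the span of the \<open>F_basis K \<delta> w\<close>
  with \<open>w \<in> cliffs \<delta> - S\<close>.\<close>

definition V_space ::
  "('k, 'a) ring_scheme \<Rightarrow> (nat \<Rightarrow> nat) \<Rightarrow> nat list set \<Rightarrow> nat \<Rightarrow> (nat list \<Rightarrow> 'k) set" where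
  "V_space K \<delta> S n =
     lin_span K (cliff_module K \<delta> n) (F_basis K \<delta> ` (cliffs_of_size \<delta> n - S))"

end

(*
  In the basis of the E_w, partial composition reads off the two pieces of a word: the coefficient
  of f o_i g on a cliff w is f (outer w) * g (inner w), where inner w is the factor of w in the
  place of the inserted word and outer w is what remains. The operad axioms then amount to the fact
  that intermediate compositions do not vanish when the final one does not, and this is where
  unimodality enters.

  The coordinate of f on F_x is the sum of its E-coefficients below x, and below x the words split
  into a word below outer x and one below inner x. Hence the F_x-coordinate of f o_i g is the product
  of the coordinates of f and g on the reductions of outer x and inner x. If x lies in S, so do these
  reductions of subwords, so the elements whose coordinates vanish on S form an ideal.
*)
theory Submission
  imports Defs
begin

section \<open>Quotients\<close>

text \<open>Cutting a cliff may produce words that are no cliffs, because letters move to smaller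
  positions. Two devices absorb this. Coefficients vanish off the cliffs of the right size, so the
  coefficients of a composite are given by one formula whatever the pieces are. And
  \<open>F_coord\<close> makes sense at every word, as a sum over all words below it, so the product
  formula is stated at the pieces themselves; reduction enters only afterwards, as the reduction of
  a word is the largest cliff below it. The two descriptions of the ideal, as a span and by
  vanishing coordinates, are linked by Moebius inversion: the coordinates are dual to the
  fundamental basis and determine an element. The quotient is built for arbitrary operad ideals. Its
  operations are unions over representatives; once each union is known to be a single coset, all
  axioms pass along the surjection onto cosets.\<close>

lemma linear_map_closed:
  "linear_map K M N f \<Longrightarrow> x \<in> carrier M \<Longrightarrow> f x \<in> carrier N"
  by (auto simp: linear_map_def hom_def)

lemma linear_map_add:
  "linear_map K M N f \<Longrightarrow> x \<in> carrier M \<Longrightarrow> y \<in> carrier M \<Longrightarrow>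
    f (x \<oplus>\<^bsub>M\<^esub> y) = f x \<oplus>\<^bsub>N\<^esub> f y"
  by (auto simp: linear_map_def hom_def)

lemma linear_map_smult:
  "linear_map K M N f \<Longrightarrow> r \<in> carrier K \<Longrightarrow> x \<in> carrier M \<Longrightarrow>
    f (r \<odot>\<^bsub>M\<^esub> x) = r \<odot>\<^bsub>N\<^esub> f x"
  by (auto simp: linear_map_def)

lemma linear_mapI:
  assumes "\<And>x. x \<in> carrier M \<Longrightarrow> f x \<in> carrier N"
    and "\<And>x y. x \<in> carrier M \<Longrightarrow> y \<in> carrier M \<Longrightarrow> f (x \<oplus>\<^bsub>M\<^esub> y) = f x \<oplus>\<^bsub>N\<^esub> f y"
    and "\<And>r x. r \<in> carrier K \<Longrightarrow> x \<in> carrier M \<Longrightarrow> f (r \<odot>\<^bsub>M\<^esub> x) = r \<odot>\<^bsub>N\<^esub> f x"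
  shows "linear_map K M N f"
  using assms by (auto simp: linear_map_def hom_def)

text \<open>Each module axiom of \<open>N\<close> is the image of the same axiom of \<open>M\<close>
  at preimages. The hypothesis \<open>zero\<close> is stated separately because
  \<open>linear_map\<close> says nothing about \<open>\<zero>\<close> of \<open>N\<close>, which is
  only a record field until the group laws are proved.\<close>

lemma module_image:
  assumes "module K M" and onto: "h ` carrier M = carrier N" and lin: "linear_map K M N h"
    and zero: "h \<zero>\<^bsub>M\<^esub> = \<zero>\<^bsub>N\<^esub>"
  shows "module K N"
proof -
  interpret M: module K M by fact
  note lin' = linear_map_add[OF lin, symmetric] linear_map_smult[OF lin, symmetric]
  show ?thesis
  proof (rule moduleI)
    show "cring K" ..
    show "abelian_group N"
    proof (rule abelian_groupI)
      fix y assume "y \<in> carrier N"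
      then obtain x where x: "x \<in> carrier M" "y = h x"
        by (auto simp: onto[symmetric])
      then have "h (\<ominus>\<^bsub>M\<^esub> x) \<oplus>\<^bsub>N\<^esub> y = \<zero>\<^bsub>N\<^esub>"
        by (simp add: lin' zero M.l_neg)
      moreover have "h (\<ominus>\<^bsub>M\<^esub> x) \<in> carrier N"
        using x by (auto simp: onto[symmetric])
      ultimately show "\<exists>z\<in>carrier N. z \<oplus>\<^bsub>N\<^esub> y = \<zero>\<^bsub>N\<^esub>" by blast
    qed (auto simp: onto[symmetric] lin' zero[symmetric] M.a_ac)
  qed (auto simp: onto[symmetric] lin' M.smult_l_distr M.smult_r_distr M.smult_assoc1)
qed

lemma abelian_subgroup_submodule:
  assumes "module K M" "submodule H K M"
  shows "abelian_subgroup H M"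
proof -
  interpret M: module K M by fact
  show ?thesis
    using submodule.axioms(1)[OF assms(2)]
    by (intro abelian_subgroupI3 additive_subgroupI M.abelian_group_axioms)
qed

text \<open>The scalar action on cosets is a union over all representatives. Two representatives
  differ by an element of \<open>H\<close>, and so do their multiples; hence the union runs over
  equal cosets and collapses.\<close>

lemma quotient_module_smult:
  assumes "module K M" "submodule H K M" "r \<in> carrier K" "x \<in> carrier M"
  shows "r \<odot>\<^bsub>quotient_module M H\<^esub> (H +>\<^bsub>M\<^esub> x) = H +>\<^bsub>M\<^esub> (r \<odot>\<^bsub>M\<^esub> x)"
proof -
  interpret M: module K M by fact
  interpret H: abelian_subgroup H M by (rule abelian_subgroup_submodule) fact+
  have eq: "H +>\<^bsub>M\<^esub> (r \<odot>\<^bsub>M\<^esub> x') = H +>\<^bsub>M\<^esub> (r \<odot>\<^bsub>M\<^esub> x)" if x': "x' \<in> H +>\<^bsub>M\<^esub> x" for x'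
  proof -
    obtain k where k: "k \<in> H" "x' = k \<oplus>\<^bsub>M\<^esub> x"
      using x' by (auto simp: a_r_coset_def')
    then have "r \<odot>\<^bsub>M\<^esub> x' \<in> H +>\<^bsub>M\<^esub> (r \<odot>\<^bsub>M\<^esub> x)"
      using assms submodule.smult_closed[OF assms(2,3), of k]
      by (auto simp: a_r_coset_def' M.smult_r_distr)
    then show ?thesis
      using assms by (metis H.a_repr_independence' M.smult_closed)
  qed
  have "(\<Union>x'\<in>H +>\<^bsub>M\<^esub> x. H +>\<^bsub>M\<^esub> (r \<odot>\<^bsub>M\<^esub> x')) = H +>\<^bsub>M\<^esub> (r \<odot>\<^bsub>M\<^esub> x)"
    using H.a_rcos_self[OF assms(4)] by (intro SUP_eq_const eq) auto
  then show ?thesis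
    by (simp add: quotient_module_def)
qed

lemma quotient_module_onto:
  "(\<lambda>x. H +>\<^bsub>M\<^esub> x) ` carrier M = carrier (quotient_module M H)"
  by (auto simp: quotient_module_def A_RCOSETS_def')

lemma quotient_map_linear:
  assumes "module K M" "submodule H K M"
  shows "linear_map K M (quotient_module M H) (\<lambda>x. H +>\<^bsub>M\<^esub> x)"
proof (rule linear_mapI)
  interpret M: module K M by fact
  interpret H: abelian_subgroup H M by (rule abelian_subgroup_submodule) fact+
  show "H +>\<^bsub>M\<^esub> x \<in> carrier (quotient_module M H)" if "x \<in> carrier M" for x
    using that by (auto simp: quotient_module_onto[symmetric])
  show "H +>\<^bsub>M\<^esub> (x \<oplus>\<^bsub>M\<^esub> y) = (H +>\<^bsub>M\<^esub> x) \<oplus>\<^bsub>quotient_module M H\<^esub> (H +>\<^bsub>M\<^esub> y)"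
    if "x \<in> carrier M" "y \<in> carrier M" for x y
    using H.a_rcos_sum[OF that] by (simp add: quotient_module_def)
qed (simp add: quotient_module_smult[OF assms])

lemma quotient_module_is_module:
  assumes "module K M" "submodule H K M"
  shows "module K (quotient_module M H)"
proof (rule module_image)
  interpret M: module K M by fact
  interpret H: abelian_subgroup H M by (rule abelian_subgroup_submodule) fact+
  show "H +>\<^bsub>M\<^esub> \<zero>\<^bsub>M\<^esub> = \<zero>\<^bsub>quotient_module M H\<^esub>"
    using H.a_subset by (simp add: quotient_module_def)
qed (rule assms quotient_module_onto quotient_map_linear)+

section \<open>Transport of the operad axioms along surjections\<close>

lemma (in ns_operad) pcomp_closed:
  assumes "1 \<le> i" "i \<le> n" "x \<in> carrier (component P n)" "y \<in> carrier (component P m)"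
  shows "pcomp P n m i x y \<in> carrier (component P (n + m - 1))"
  using linear_map_closed[OF pcomp_linear_left[OF assms(1,2,4)] assms(3)] .

text \<open>The counterpart of \<open>module_image\<close> for operads: every element of
  \<open>Q\<close> has a preimage under \<open>h\<close>, and \<open>comp\<close> pulls each axiom
  back to \<open>P\<close>.\<close>

lemma ns_operad_image:
  assumes "ns_operad K P"
    and mod: "\<And>n. module K (component Q n)"
    and lin: "\<And>n. linear_map K (component P n) (component Q n) (h n)"
    and onto: "\<And>n. h n ` carrier (component P n) = carrier (component Q n)"
    and comp: "\<And>n m i x y. \<lbrakk>1 \<le> i; i \<le> n; x \<in> carrier (component P n); y \<in> carrier (component P m)\<rbrakk>
        \<Longrightarrow> pcomp Q n m i (h n x) (h m y) = h (n + m - 1) (pcomp P n m i x y)"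
    and unit: "h 1 (ounit P) = ounit Q"
  shows "ns_operad K Q"
proof -
  interpret P: ns_operad K P by fact
  note lin' = linear_map_add[OF lin, symmetric] linear_map_smult[OF lin, symmetric]
  note closed = P.pcomp_closed linear_map_closed[OF lin]
  interpret M: module K "component P n" for n by (rule P.component_module)
  show ?thesis
  proof (intro ns_operad.intro ns_operad_axioms.intro)
    show "field K" by (rule P.field_axioms)
    show "module K (component Q n)" for n by (rule mod)
    show "ounit Q \<in> carrier (component Q 1)"
      using linear_map_closed[OF lin P.ounit_closed] by (simp only: unit)
    show "linear_map K (component Q n) (component Q (n + m - 1)) (\<lambda>x. pcomp Q n m i x y)"
      if "1 \<le> i" "i \<le> n" "y \<in> carrier (component Q m)" for i n m y
      using that
      by (intro linear_mapI)
        (auto simp: onto[symmetric] comp lin' closed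
          linear_map_add[OF P.pcomp_linear_left] linear_map_smult[OF P.pcomp_linear_left]
          simp del: One_nat_def)
    show "linear_map K (component Q m) (component Q (n + m - 1)) (\<lambda>y. pcomp Q n m i x y)"
      if "1 \<le> i" "i \<le> n" "x \<in> carrier (component Q n)" for i n m x
      using that
      by (intro linear_mapI)
        (auto simp: onto[symmetric] comp lin' closed
          linear_map_add[OF P.pcomp_linear_right] linear_map_smult[OF P.pcomp_linear_right]
          simp del: One_nat_def)
    fix n x assume x: "x \<in> carrier (component Q n)"
    then obtain x' where x': "x = h n x'" "x' \<in> carrier (component P n)"
      by (auto simp: onto[symmetric])
    show "pcomp Q 1 n 1 (ounit Q) x = x"
      using x' comp[of 1 1 "ounit P" x' n] P.ounit_closed P.ounit_left[of x' n]
      by (simp add: unit[symmetric])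
    show "pcomp Q n 1 i x (ounit Q) = x" if "1 \<le> i" "i \<le> n" for i
      using x' that comp[of i n x' "ounit P" 1] P.ounit_closed P.ounit_right[of i n x']
      by (simp add: unit[symmetric])
    fix m l y z assume "y \<in> carrier (component Q m)" "z \<in> carrier (component Q l)"
    then obtain y' z' where y': "y = h m y'" "y' \<in> carrier (component P m)"
      and z': "z = h l z'" "z' \<in> carrier (component P l)"
      by (auto simp: onto[symmetric])
    show "pcomp Q (n + m - 1) l (i + j - 1) (pcomp Q n m i x y) z
        = pcomp Q n (m + l - 1) i x (pcomp Q m l j y z)"
      if "1 \<le> i" "i \<le> n" "1 \<le> j" "j \<le> m" for i j
    proof -
      \<comment> \<open>The two sides apply \<open>h\<close> at arities that are written
        differently. With truncated subtraction they can differ for \<open>m = 0\<close>, which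
        \<open>1 \<le> j\<close> and \<open>j \<le> m\<close> exclude.\<close>
      have ar: "n + m - 1 + l - 1 = n + (m + l - 1) - 1" "1 \<le> i + j - 1" "i + j - 1 \<le> n + m - 1"
        using that by auto
      show ?thesis
        using that x' y' z' ar
        by (simp only: comp P.pcomp_closed P.pcomp_sequential)
    qed
    show "pcomp Q (n + m - 1) l (j + m - 1) (pcomp Q n m i x y) z
        = pcomp Q (n + l - 1) m i (pcomp Q n l j x z) y"
      if "1 \<le> i" "i < j" "j \<le> n" for i j
    proof -
      \<comment> \<open>From \<open>i < j\<close> and \<open>j \<le> n\<close> follows
        \<open>i \<le> n + l - 1\<close> even for \<open>l = 0\<close>, so place \<open>i\<close> is
        still available after the composition at \<open>j\<close>.\<close>
      have ar: "n + m - 1 + l - 1 = n + l - 1 + m - 1" "1 \<le> j + m - 1" "j + m - 1 \<le> n + m - 1"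
          "i \<le> n" "1 \<le> j" "i \<le> n + l - 1"
        using that by auto
      show ?thesis
        using that x' y' z' ar
        by (simp only: comp P.pcomp_closed P.pcomp_parallel)
    qed
  qed
qed

section \<open>The quotient by an operad ideal\<close>

context operad_ideal
begin

abbreviation coset :: "nat \<Rightarrow> 'v \<Rightarrow> 'v set" where
  "coset n x \<equiv> I n +>\<^bsub>component P n\<^esub> x"

lemma coset_linear:
  "linear_map K (component P n) (component (quotient_operad P I) n) (coset n)"
  by (simp add: quotient_operad_def quotient_map_linear component_module ideal_submodule)

lemma coset_onto:
  "coset n ` carrier (component P n) = carrier (component (quotient_operad P I) n)"
  by (simp add: quotient_operad_def quotient_module_onto)

lemma coset_eqI:
  assumes "x \<in> carrier (component P n)" "k \<in> I n"
  shows "coset n (k \<oplus>\<^bsub>component P n\<^esub> x) = coset n x"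
proof -
  interpret M: module K "component P n" by (rule component_module)
  interpret H: abelian_subgroup "I n" "component P n"
    by (rule abelian_subgroup_submodule[OF component_module ideal_submodule])
  have "k \<oplus>\<^bsub>component P n\<^esub> x \<in> coset n x"
    using assms by (auto simp: a_r_coset_def')
  then show ?thesis
    using assms by (metis H.a_repr_independence')
qed

text \<open>Representatives are changed one at a time: replacing \<open>x'\<close> by
  \<open>x\<close> alters the composite by an element of the ideal through
  \<open>ideal_left\<close>, replacing \<open>y'\<close> by \<open>y\<close> through
  \<open>ideal_right\<close>. The union that defines the composition of cosets thus consists of
  equal cosets.\<close>

lemma coset_pcomp:
  assumes "1 \<le> i" "i \<le> n" "x \<in> carrier (component P n)" "y \<in> carrier (component P m)"
  shows "pcomp (quotient_operad P I) n m i (coset n x) (coset m y)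
    = coset (n + m - 1) (pcomp P n m i x y)"
proof -
  interpret N: module K "component P n" by (rule component_module)
  interpret M: module K "component P m" by (rule component_module)
  interpret HN: abelian_subgroup "I n" "component P n"
    by (rule abelian_subgroup_submodule[OF component_module ideal_submodule])
  interpret HM: abelian_subgroup "I m" "component P m"
    by (rule abelian_subgroup_submodule[OF component_module ideal_submodule])
  have eq: "coset (n + m - 1) (pcomp P n m i x' y') = coset (n + m - 1) (pcomp P n m i x y)"
    if x': "x' \<in> coset n x" and y': "y' \<in> coset m y" for x' y'
  proof -
    obtain k where k: "k \<in> I n" "x' = k \<oplus>\<^bsub>component P n\<^esub> x"
      using x' by (auto simp: a_r_coset_def')
    obtain l where l: "l \<in> I m" "y' = l \<oplus>\<^bsub>component P m\<^esub> y"
      using y' by (auto simp: a_r_coset_def')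
    have y'c: "y' \<in> carrier (component P m)"
      using l assms by simp
    have "pcomp P n m i x' y'
        = pcomp P n m i k y' \<oplus>\<^bsub>component P (n + m - 1)\<^esub> pcomp P n m i x y'"
      using linear_map_add[OF pcomp_linear_left[OF assms(1,2) y'c]] k assms by simp
    then have "coset (n + m - 1) (pcomp P n m i x' y') = coset (n + m - 1) (pcomp P n m i x y')"
      using coset_eqI[OF pcomp_closed[OF assms(1-3) y'c] ideal_left[OF assms(1,2) k(1) y'c]] by simp
    moreover have "pcomp P n m i x y'
        = pcomp P n m i x l \<oplus>\<^bsub>component P (n + m - 1)\<^esub> pcomp P n m i x y"
      using linear_map_add[OF pcomp_linear_right[OF assms(1,2,3)]] l assms by simp
    then have "coset (n + m - 1) (pcomp P n m i x y') = coset (n + m - 1) (pcomp P n m i x y)"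
      using coset_eqI[OF pcomp_closed[OF assms] ideal_right[OF assms(1-3) l(1)]] by simp
    ultimately show ?thesis by simp
  qed
  have self: "x \<in> coset n x" "y \<in> coset m y"
    using HN.a_rcos_self HM.a_rcos_self assms by auto
  have "(\<Union>x'\<in>coset n x. \<Union>y'\<in>coset m y. coset (n + m - 1) (pcomp P n m i x' y'))
      = coset (n + m - 1) (pcomp P n m i x y)"
    using self by (intro SUP_eq_const eq) auto
  then show ?thesis
    by (simp only: quotient_operad_def operad_data.simps)
qed

lemma coset_ounit: "coset 1 (ounit P) = ounit (quotient_operad P I)"
  by (simp add: quotient_operad_def)

lemma quotient_ns_operad: "ns_operad K (quotient_operad P I)"
proof (rule ns_operad_image[OF ns_operad_axioms _ coset_linear coset_onto coset_pcomp coset_ounit])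
  show "module K (component (quotient_operad P I) n)" for n
    by (simp add: quotient_operad_def quotient_module_is_module component_module ideal_submodule)
qed

lemma quotient_operad_hom: "operad_hom K P (quotient_operad P I) coset"
  by (intro operad_hom.intro operad_hom_axioms.intro ns_operad_axioms quotient_ns_operad
      coset_linear coset_ounit coset_pcomp[symmetric])

end

section \<open>Words and cliffs\<close>

lemma cliffs_iff: "w \<in> cliffs \<delta> \<longleftrightarrow> (\<forall>p<length w. w ! p \<le> \<delta> (Suc p))"
proof -
  have "(\<forall>i\<in>{1..n}. P i) \<longleftrightarrow> (\<forall>p<n. P (Suc p))" for n and P :: "nat \<Rightarrow> bool"
    by (metis Suc_le_eq atLeastAtMost_iff le_add1 less_eq_nat.simps(1) not0_implies_Suc not_one_le_zero plus_1_eq_Suc)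
  from this[of "length w" "\<lambda>i. w ! (i - 1) \<le> \<delta> i"] show ?thesis
    by (simp add: cliffs_def)
qed

lemma length_reduction [simp]: "length (reduction \<delta> w) = length w"
  by (simp add: reduction_def del: upt_Suc)

lemma nth_reduction: "p < length w \<Longrightarrow> reduction \<delta> w ! p = min (w ! p) (\<delta> (Suc p))"
  by (simp add: reduction_def del: upt_Suc)

lemma reduction_in_cliffs: "reduction \<delta> w \<in> cliffs \<delta>"
  by (simp add: cliffs_iff nth_reduction)

lemma word_le_iff: "u \<preceq> v \<longleftrightarrow> length u = length v \<and> (\<forall>p<length v. u ! p \<le> v ! p)"
  by (auto simp: word_le_def list_all2_conv_all_nth)

lemma word_le_refl [simp]: "u \<preceq> u"
  by (simp add: word_le_iff)

lemma word_le_antisym: "u \<preceq> v \<Longrightarrow> v \<preceq> u \<Longrightarrow> u = v"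
  by (auto simp: word_le_iff intro!: nth_equalityI order.antisym)

lemma word_le_append:
  "length a = length b \<Longrightarrow> a @ c \<preceq> b @ d \<longleftrightarrow> a \<preceq> b \<and> c \<preceq> d"
  by (auto simp: word_le_def list_all2_append dest: list_all2_lengthD)

lemma word_le_trans: "u \<preceq> v \<Longrightarrow> v \<preceq> w \<Longrightarrow> u \<preceq> w"
  by (force simp: word_le_iff intro: order.trans)

text \<open>Cliffs form a down-set, so a sum over all words below a cliff meets only cliffs.\<close>

lemma word_le_cliff: "w \<preceq> x \<Longrightarrow> x \<in> cliffs \<delta> \<Longrightarrow> w \<in> cliffs \<delta>"
  by (force simp: word_le_iff cliffs_iff intro: order.trans)

text \<open>Reduction is the letterwise meet with the values of \<open>\<delta>\<close>. This is
  what makes the coordinates of an element insensitive to reduction.\<close>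

lemma word_le_reduction_iff: "w \<preceq> reduction \<delta> x \<longleftrightarrow> w \<preceq> x \<and> w \<in> cliffs \<delta>"
  by (auto simp: word_le_iff cliffs_iff nth_reduction)

lemma finite_word_le [simp]: "finite {w. w \<preceq> x}"
proof (induction x)
  case Nil
  then show ?case by (simp add: word_le_def)
next
  case (Cons a x)
  have "{w. w \<preceq> a # x} = (\<lambda>(b, w). b # w) ` ({..a} \<times> {w. w \<preceq> x})"
    by (auto simp: word_le_def list_all2_Cons2 image_iff)
  with Cons show ?case by simp
qed

lemma finite_cliffs_of_size [simp]: "finite (cliffs_of_size \<delta> n)"
proof (rule finite_subset)
  \<comment> \<open>The bound is the largest cliff of size \<open>n\<close>; it has
    \<open>n - 1\<close> letters, since size exceeds length by one.\<close>
  show "cliffs_of_size \<delta> n \<subseteq> {w. w \<preceq> map \<delta> [1..<n]}"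
    by (auto simp: cliffs_of_size_def wsize_def cliffs_iff word_le_iff)
qed simp

lemma cliffs_of_size_iff:
  "w \<in> cliffs_of_size \<delta> n \<longleftrightarrow> w \<in> cliffs \<delta> \<and> Suc (length w) = n"
  by (simp add: cliffs_of_size_def wsize_def)

text \<open>The component of arity zero is therefore trivial. This settles the cases in which an
  arity is zero and the truncated subtractions below no longer count letters.\<close>

lemma cliffs_of_size_0 [simp]: "cliffs_of_size \<delta> 0 = {}"
  by (auto simp: cliffs_of_size_iff)

text \<open>Unimodality as quasi-concavity: a value below \<open>k\<close> at \<open>b\<close> would
  make \<open>b\<close> a valley between \<open>a\<close> and \<open>c\<close>.\<close>

lemma unimodal_min_le:
  assumes "unimodal \<delta>" "1 \<le> a" "a \<le> b" "b \<le> c" "k \<le> \<delta> a" "k \<le> \<delta> c"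
  shows "k \<le> \<delta> b"
proof (rule ccontr)
  assume "\<not> k \<le> \<delta> b"
  then have "\<delta> a > \<delta> b" "\<delta> b < \<delta> c" "a < b" "b < c"
    using assms by (auto simp: order.order_iff_strict)
  with assms(1,2) show False
    unfolding unimodal_def by blast
qed

text \<open>Deleting letters can only move the remaining ones to the left.\<close>

lemma subseq_nth_shift:
  "subseq y w \<Longrightarrow> p < length y \<Longrightarrow> \<exists>q\<ge>p. q < length w \<and> w ! q = y ! p"
proof (induction arbitrary: p rule: list_emb.induct)
  case (list_emb_Cons xs ys y)
  then obtain q where "q \<ge> p" "q < length ys" "ys ! q = xs ! p" by blast
  then show ?case by (intro exI[of _ "Suc q"]) auto
next
  case (list_emb_Cons2 x y xs ys)
  show ?case
  proof (cases p)
    case 0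
    with list_emb_Cons2 show ?thesis by auto
  next
    case (Suc p')
    with list_emb_Cons2 obtain q where "q \<ge> p'" "q < length ys" "ys ! q = xs ! p'"
      by (metis Suc_less_eq length_Cons)
    with Suc show ?thesis by (intro exI[of _ "Suc q"]) auto
  qed
qed simp

text \<open>Each letter of \<open>a @ y @ b\<close> sits between its position in \<open>a @ b\<close> or \<open>y\<close> and its position
  in \<open>w\<close>, so that unimodality bounds it.\<close>

lemma insertion_in_cliffs:
  assumes "unimodal \<delta>" "w \<in> cliffs \<delta>" "subseq (a @ y @ b) w"
    and ab: "a @ b \<in> cliffs \<delta>" and y: "y \<in> cliffs \<delta>"
  shows "a @ y @ b \<in> cliffs \<delta>"
  unfolding cliffs_iff
proof (intro allI impI)
  fix p assume p: "p < length (a @ y @ b)"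
  obtain q where q: "q \<ge> p" "q < length w" "w ! q = (a @ y @ b) ! p"
    using subseq_nth_shift[OF assms(3) p] by blast
  have "\<exists>r\<le>p. (a @ y @ b) ! p \<le> \<delta> (Suc r)"
  proof -
    consider "p < length a" | "length a \<le> p" "p < length a + length y" | "length a + length y \<le> p"
      by linarith
    then show ?thesis
    proof cases
      case 1
      with ab show ?thesis
        by (intro exI[of _ p]) (auto simp: cliffs_iff nth_append dest: spec[of _ p])
    next
      case 2
      with y show ?thesis
        by (intro exI[of _ "p - length a"]) (auto simp: cliffs_iff nth_append)
    next
      \<comment> \<open>A letter of \<open>b\<close> stands \<open>length y\<close> places earlier
        in \<open>a @ b\<close>.\<close>
      case 3
      with p have "p - length y < length (a @ b)" by auto
      with ab have "(a @ b) ! (p - length y) \<le> \<delta> (Suc (p - length y))"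
        unfolding cliffs_iff by blast
      moreover have "(a @ y @ b) ! p = (a @ b) ! (p - length y)"
        using 3 by (auto simp: nth_append diff_commute add.commute)
      ultimately show ?thesis
        by (intro exI[of _ "p - length y"]) auto
    qed
  qed
  then obtain r where "r \<le> p" "(a @ y @ b) ! p \<le> \<delta> (Suc r)" by blast
  then show "(a @ y @ b) ! p \<le> \<delta> (Suc p)"
    using q assms(2) unimodal_min_le[OF assms(1), of "Suc r" "Suc p" "Suc q"]
    by (auto simp: cliffs_iff)
qed

text \<open>In compositions at place \<open>i\<close> with an element of arity \<open>m\<close>, the
  arguments are \<open>a = i - 1\<close>, the number of letters before the inserted word, and
  \<open>k = m - 1\<close>, its length.\<close>

definition inner :: "nat \<Rightarrow> nat \<Rightarrow> 'a list \<Rightarrow> 'a list" where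
  "inner a k w = take k (drop a w)"

definition outer :: "nat \<Rightarrow> nat \<Rightarrow> 'a list \<Rightarrow> 'a list" where
  "outer a k w = take a w @ drop (a + k) w"

lemma inner_append: "length a = n \<Longrightarrow> length y = k \<Longrightarrow> inner n k (a @ y @ b) = y"
  by (simp add: inner_def)

lemma outer_append: "length a = n \<Longrightarrow> length y = k \<Longrightarrow> outer n k (a @ y @ b) = a @ b"
  by (simp add: outer_def)

lemma subseq_inner: "subseq (inner a k w) w"
  by (metis append_take_drop_id inner_def subseq_drop_many subseq_order.trans list_emb_append2
      subseq_rev_drop_many subseq_order.refl)

lemma subseq_outer: "subseq (outer a k w) w"
proof -
  have "subseq (drop (a + k) w) (drop a w)"
    by (metis add.commute drop_drop append_take_drop_id list_emb_append2 subseq_order.refl)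
  then have "subseq (take a w @ drop (a + k) w) (take a w @ drop a w)"
    by (simp only: subseq_append')
  then show ?thesis by (simp add: outer_def)
qed

lemma length_decompose3:
  assumes "length w = a + k + b"
  obtains x y z where "w = x @ y @ z" "length x = a" "length y = k" "length z = b"
proof
  show "w = take a w @ take k (drop a w) @ drop (a + k) w"
    by (metis append_take_drop_id add.commute drop_drop)
qed (use assms in auto)

lemma insert_word_append: "length a = i - 1 \<Longrightarrow> insert_word (a @ b) i y = a @ y @ b"
  by (simp add: insert_word_def)

text \<open>Once the lengths are fixed, cutting undoes insertion. Hence at most one pair of words
  contributes to a given coefficient of a composite.\<close>

lemma insert_word_eq_iff:
  assumes "i - 1 + length v \<le> length w" "length u + length v = length w"
  shows "insert_word u i v = w \<longleftrightarrow> u = outer (i - 1) (length v) w \<and> v = inner (i - 1) (length v) w"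
proof -
  obtain x y z where w: "w = x @ y @ z" "length x = i - 1" "length y = length v"
    using length_decompose3[of w "i - 1" "length v" "length w - (i - 1) - length v"] assms by auto
  have u: "u = take (i - 1) u @ drop (i - 1) u" "length (take (i - 1) u) = length x"
    using assms w by auto
  have "insert_word u i v = w \<longleftrightarrow> take (i - 1) u = x \<and> v = y \<and> drop (i - 1) u = z"
    using w u(2) by (auto simp: insert_word_def)
  also have "\<dots> \<longleftrightarrow> u = x @ z \<and> v = y"
    using u by (metis append_eq_append_conv)
  finally show ?thesis
    using w by (simp add: inner_append outer_append)
qed

lemma length_insert_word: "length (insert_word u i v) = length u + length v"
  by (simp add: insert_word_def)

section \<open>The operad of cliffs\<close>

lemma cliff_module_simps [simp]:
  "f \<oplus>\<^bsub>cliff_module K \<delta> n\<^esub> g = (\<lambda>w. f w \<oplus>\<^bsub>K\<^esub> g w)"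
  "\<zero>\<^bsub>cliff_module K \<delta> n\<^esub> = (\<lambda>w. \<zero>\<^bsub>K\<^esub>)"
  "r \<odot>\<^bsub>cliff_module K \<delta> n\<^esub> f = (\<lambda>w. r \<otimes>\<^bsub>K\<^esub> f w)"
  by (simp_all add: cliff_module_def)

lemma cliff_module_carrier_iff:
  "f \<in> carrier (cliff_module K \<delta> n) \<longleftrightarrow>
    (\<forall>w. f w \<in> carrier K) \<and> (\<forall>w. w \<notin> cliffs_of_size \<delta> n \<longrightarrow> f w = \<zero>\<^bsub>K\<^esub>)"
  by (simp add: cliff_module_def)

lemma cliff_operad_component [simp]: "component (cliff_operad K \<delta>) = cliff_module K \<delta>"
  by (simp add: cliff_operad_def)

section \<open>Components and coefficients of composites\<close>

context field
begin

lemma cliff_module_closed [simp]: "f \<in> carrier (cliff_module R \<delta> n) \<Longrightarrow> f w \<in> carrier R"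
  by (simp add: cliff_module_carrier_iff)

lemma cliff_module_support:
  "f \<in> carrier (cliff_module R \<delta> n) \<Longrightarrow> w \<notin> cliffs_of_size \<delta> n \<Longrightarrow> f w = \<zero>"
  by (simp add: cliff_module_carrier_iff)

lemma cliff_module_is_module: "module R (cliff_module R \<delta> n)"
proof (rule moduleI)
  show "cring R" ..
  show "abelian_group (cliff_module R \<delta> n)"
  proof (rule abelian_groupI)
    fix f assume "f \<in> carrier (cliff_module R \<delta> n)"
    then show "\<exists>g\<in>carrier (cliff_module R \<delta> n). g \<oplus>\<^bsub>cliff_module R \<delta> n\<^esub> f = \<zero>\<^bsub>cliff_module R \<delta> n\<^esub>"
      by (intro bexI[of _ "\<lambda>w. \<ominus> f w"]) (auto simp: cliff_module_carrier_iff l_neg)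
  qed (auto simp: cliff_module_carrier_iff a_ac)
qed (auto simp: cliff_module_carrier_iff l_distr r_distr m_assoc)

lemma finsum_cliff_module:
  assumes "g \<in> A \<rightarrow> carrier (cliff_module R \<delta> n)"
  shows "finsum (cliff_module R \<delta> n) g A w = (\<Oplus>a\<in>A. g a w)"
proof -
  interpret M: module R "cliff_module R \<delta> n" by (rule cliff_module_is_module)
  show ?thesis
    using assms
  \<comment> \<open>Over an infinite index set both sums are zero by convention.\<close>
  proof (induction A rule: infinite_finite_induct)
    case (insert a A)
    then have "g b w \<in> carrier R" if "b \<in> insert a A" for b
      using that cliff_module_closed[of "g b" \<delta> n w] by blast
    with insert show ?case by (simp add: Pi_iff)
  qed auto
qed

lemma E_basis_in_carrier: "w \<in> cliffs_of_size \<delta> n \<Longrightarrow> E_basis R w \<in> carrier (cliff_module R \<delta> n)"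
  by (auto simp: E_basis_def cliff_module_carrier_iff)

lemma E_pcomp_in_carrier:
  assumes "u \<in> cliffs_of_size \<delta> n" "v \<in> cliffs_of_size \<delta> m"
  shows "E_pcomp R \<delta> i u v \<in> carrier (cliff_module R \<delta> (n + m - 1))"
proof (cases "insert_word u i v \<in> cliffs \<delta>")
  case True
  with assms have "insert_word u i v \<in> cliffs_of_size \<delta> (n + m - 1)"
    by (auto simp: cliffs_of_size_iff length_insert_word)
  with True show ?thesis
    by (simp add: E_pcomp_def E_basis_in_carrier)
qed (simp add: E_pcomp_def cliff_module_carrier_iff)

lemma finsum_eq_zero: "(\<And>a. a \<in> A \<Longrightarrow> f a = \<zero>) \<Longrightarrow> (\<Oplus>a\<in>A. f a) = \<zero>"
  by (rule add.finprod_one_eqI)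

lemma finsum_eq_single:
  assumes "finite A" "a \<in> A" "f a \<in> carrier R" "\<And>b. b \<in> A \<Longrightarrow> b \<noteq> a \<Longrightarrow> f b = \<zero>"
  shows "(\<Oplus>b\<in>A. f b) = f a"
proof -
  have "(\<Oplus>b\<in>A. f b) = (\<Oplus>b\<in>{a}. f b)"
  proof (rule add.finprod_mono_neutral_cong_right)
    show "f \<in> A \<rightarrow> carrier R" using assms(3,4) by (metis Pi_I zero_closed)
  qed (use assms in auto)
  with assms(3) show ?thesis by simp
qed

text \<open>Only the pair cut out of \<open>w\<close> can produce \<open>w\<close>, so the defining
  double sum collapses to one product. The formula also covers \<open>m = 0\<close>, where
  \<open>g\<close> is zero and both sides vanish.\<close>

lemma pcomp_eval:
  assumes i: "1 \<le> i" "i \<le> n"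
    and f: "f \<in> carrier (cliff_module R \<delta> n)" and g: "g \<in> carrier (cliff_module R \<delta> m)"
  shows "pcomp (cliff_operad R \<delta>) n m i f g w =
    (if w \<in> cliffs_of_size \<delta> (n + m - 1)
     then f (outer (i - 1) (m - 1) w) \<otimes> g (inner (i - 1) (m - 1) w) else \<zero>)"
proof -
  let ?M = "cliff_module R \<delta> (n + m - 1)"
  let ?A = "cliffs_of_size \<delta> n \<times> cliffs_of_size \<delta> m"
  let ?t = "\<lambda>p. (f (fst p) \<otimes> g (snd p)) \<otimes> E_pcomp R \<delta> i (fst p) (snd p) w"
  let ?o = "outer (i - 1) (m - 1) w" and ?i = "inner (i - 1) (m - 1) w"
  interpret M: module R ?M by (rule cliff_module_is_module)
  let ?g = "\<lambda>p. (f (fst p) \<otimes> g (snd p)) \<odot>\<^bsub>?M\<^esub> E_pcomp R \<delta> i (fst p) (snd p)"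
  have pc: "pcomp (cliff_operad R \<delta>) n m i f g = finsum ?M ?g ?A"
    by (simp add: cliff_operad_def case_prod_unfold)
  have "?g \<in> ?A \<rightarrow> carrier ?M"
    using f g by (intro funcsetI M.smult_closed E_pcomp_in_carrier) auto
  from finsum_cliff_module[OF this, of w]
  have eval: "pcomp (cliff_operad R \<delta>) n m i f g w = (\<Oplus>p\<in>?A. ?t p)"
    by (simp only: pc cliff_module_simps)
  show ?thesis
  proof (cases "w \<in> cliffs_of_size \<delta> (n + m - 1)")
    case False
    have "?t p = \<zero>" if "p \<in> ?A" for p
    proof -
      have "E_pcomp R \<delta> i (fst p) (snd p) w = \<zero>"
        using cliff_module_support[OF E_pcomp_in_carrier False] that by auto
      with f g show ?thesis by simp
    qed
    with False show ?thesis
      unfolding eval by (simp add: finsum_eq_zero)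
  next
    case w: True
    have pt: "?t p = (if p = (?o, ?i) then f ?o \<otimes> g ?i else \<zero>)" if p: "p \<in> ?A" for p
    proof -
      have len: "Suc (length (fst p)) = n" "Suc (length (snd p)) = m" "Suc (length w) = n + m - 1"
        using p w by (auto simp: cliffs_of_size_iff)
      then have "length (snd p) = m - 1" by simp
      with len have iff: "insert_word (fst p) i (snd p) = w \<longleftrightarrow> p = (?o, ?i)"
        using i insert_word_eq_iff[of i "snd p" w "fst p"] by (simp add: prod_eq_iff)
      show ?thesis
      proof (cases "p = (?o, ?i)")
        case True
        then have "E_pcomp R \<delta> i (fst p) (snd p) w = \<one>"
          using iff w by (simp add: E_pcomp_def E_basis_def cliffs_of_size_iff)
        with True f g show ?thesis by simp
      next
        case False
        then have "E_pcomp R \<delta> i (fst p) (snd p) w = \<zero>"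
          using iff by (simp add: E_pcomp_def E_basis_def eq_commute[of w])
        with False f g show ?thesis by simp
      qed
    qed
    have "(\<Oplus>p\<in>?A. ?t p) = f ?o \<otimes> g ?i"
    proof (cases "(?o, ?i) \<in> ?A")
      case True
      have "(\<Oplus>p\<in>?A. ?t p) = ?t (?o, ?i)"
        by (rule finsum_eq_single) (use True f g pt in auto)
      with pt[OF True] show ?thesis by simp
    next
      \<comment> \<open>If the pieces are not cliffs of the right sizes, the pair is missing from
        the sum, and the product is zero as well because \<open>f\<close> or \<open>g\<close>
        vanishes off its support.\<close>
      case False
      then have "f ?o \<otimes> g ?i = \<zero>"
        using f g by (auto simp: cliff_module_support)
      moreover have "(\<Oplus>p\<in>?A. ?t p) = \<zero>"
        by (rule finsum_eq_zero) (use False pt in auto)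
      ultimately show ?thesis by simp
    qed
    with w show ?thesis unfolding eval by simp
  qed
qed

section \<open>The operad axioms\<close>

lemma cliff_pcomp_closed:
  assumes "1 \<le> i" "i \<le> n" "f \<in> carrier (cliff_module R \<delta> n)" "g \<in> carrier (cliff_module R \<delta> m)"
  shows "pcomp (cliff_operad R \<delta>) n m i f g \<in> carrier (cliff_module R \<delta> (n + m - 1))"
  using assms(3,4) by (simp add: cliff_module_carrier_iff[of "pcomp _ _ _ _ _ _"] pcomp_eval[OF assms])

lemma cliff_pcomp_linear_left:
  assumes "1 \<le> i" "i \<le> n" "g \<in> carrier (cliff_module R \<delta> m)"
  shows "linear_map R (cliff_module R \<delta> n) (cliff_module R \<delta> (n + m - 1))
    (\<lambda>f. pcomp (cliff_operad R \<delta>) n m i f g)"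
proof -
  interpret M: module R "cliff_module R \<delta> n" by (rule cliff_module_is_module)
  \<comment> \<open>The closure rules are put into the pointwise form to which the simplifier
    rewrites sums and multiples.\<close>
  note closed = M.a_closed[simplified] M.smult_closed[simplified]
  show ?thesis
    using assms
    by (intro linear_mapI ext) (simp_all add: cliff_pcomp_closed pcomp_eval closed l_distr m_assoc
        del: One_nat_def)
qed

lemma cliff_pcomp_linear_right:
  assumes "1 \<le> i" "i \<le> n" "f \<in> carrier (cliff_module R \<delta> n)"
  shows "linear_map R (cliff_module R \<delta> m) (cliff_module R \<delta> (n + m - 1))
    (\<lambda>g. pcomp (cliff_operad R \<delta>) n m i f g)"
proof -
  interpret M: module R "cliff_module R \<delta> m" by (rule cliff_module_is_module)
  note closed = M.a_closed[simplified] M.smult_closed[simplified]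
  show ?thesis
    using assms
    by (intro linear_mapI ext) (simp_all add: cliff_pcomp_closed pcomp_eval closed r_distr m_lcomm
        del: One_nat_def)
qed

text \<open>At a cliff \<open>w = a @ b @ c @ d @ e\<close> both sides should be the product of
  \<open>x (a @ e)\<close>, \<open>y (b @ d)\<close> and \<open>z c\<close>. The left side passes
  through the word \<open>a @ b @ d @ e\<close>, the right side through \<open>b @ c @ d\<close>. If
  the three pieces are cliffs, then so are these words, by \<open>insertion_in_cliffs\<close>;
  otherwise one of the three factors is zero and both sides vanish.\<close>

lemma cliff_pcomp_sequential:
  assumes "unimodal \<delta>" and ij: "1 \<le> i" "i \<le> n" "1 \<le> j" "j \<le> m"
    and x: "x \<in> carrier (cliff_module R \<delta> n)" and y: "y \<in> carrier (cliff_module R \<delta> m)"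
    and z: "z \<in> carrier (cliff_module R \<delta> l)"
  defines "P \<equiv> cliff_operad R \<delta>"
  shows "pcomp P (n + m - 1) l (i + j - 1) (pcomp P n m i x y) z
    = pcomp P n (m + l - 1) i x (pcomp P m l j y z)"
proof (rule ext)
  fix w
  have ar: "n + m - 1 + l - 1 = n + (m + l - 1) - 1" "1 \<le> i + j - 1" "i + j - 1 \<le> n + m - 1"
    using ij by auto
  note closed = cliff_pcomp_closed[OF ij(1,2) x y] cliff_pcomp_closed[OF ij(3,4) y z]
  note eval = pcomp_eval[OF ar(2,3) closed(1) z] pcomp_eval[OF ij(1,2) x closed(2)]
    pcomp_eval[OF ij(1,2) x y] pcomp_eval[OF ij(3,4) y z]
  show "pcomp P (n + m - 1) l (i + j - 1) (pcomp P n m i x y) z w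
    = pcomp P n (m + l - 1) i x (pcomp P m l j y z) w"
  \<comment> \<open>Off the cliffs of the final size both sides are zero by
    \<open>pcomp_eval\<close>; for \<open>l = 0\<close> they are zero because \<open>z\<close>
    is.\<close>
  proof (cases "w \<in> cliffs_of_size \<delta> (n + m - 1 + l - 1) \<and> l \<noteq> 0")
    case False
    then show ?thesis
      using x y cliff_module_support[OF z] unfolding P_def eval ar(1) by auto
  next
    case True
    \<comment> \<open>These names remove the truncated subtractions: \<open>p\<close> and
      \<open>p'\<close> count the letters before and after place \<open>i\<close> in the words of
      \<open>x\<close>, \<open>q\<close> and \<open>q'\<close> those around place \<open>j\<close>
      in the words of \<open>y\<close>, and \<open>l'\<close> is the length of the words of
      \<open>z\<close>.\<close>
    obtain p p' q q' l' where num: "i = Suc p" "n = Suc p + p'" "j = Suc q" "m = Suc q + q'"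
        "l = Suc l'"
      using ij True by (metis Suc_le_D One_nat_def le_Suc_ex not0_implies_Suc)
    have "length w = p + (q + l' + q') + p'"
      using True by (simp add: cliffs_of_size_iff num)
    then obtain a v e where v: "w = a @ v @ e" "length a = p" "length v = q + l' + q'"
        "length e = p'"
      by (rule length_decompose3)
    obtain b c d where bcd: "v = b @ c @ d" "length b = q" "length c = l'" "length d = q'"
      using v(3) by (rule length_decompose3)
    have len: "length (a @ b) = i + j - 1 - 1" "length (b @ c @ d) = m + l - 1 - 1"
      "length (b @ d) = m - 1" "length c = l - 1" "length a = i - 1" "length b = j - 1"
      by (simp_all add: v bcd num)
    have words: "outer (i + j - 1 - 1) (l - 1) w = a @ (b @ d) @ e"
      "inner (i + j - 1 - 1) (l - 1) w = c"
      "outer (i - 1) (m + l - 1 - 1) w = a @ e"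
      "inner (i - 1) (m + l - 1 - 1) w = b @ c @ d"
      "outer (i - 1) (m - 1) (a @ (b @ d) @ e) = a @ e"
      "inner (i - 1) (m - 1) (a @ (b @ d) @ e) = b @ d"
      "outer (j - 1) (l - 1) (b @ c @ d) = b @ d"
      "inner (j - 1) (l - 1) (b @ c @ d) = c"
      using outer_append[OF len(1,4), of "d @ e"] inner_append[OF len(1,4), of "d @ e"]
        outer_append[OF len(5,2), of e] inner_append[OF len(5,2), of e]
        outer_append[OF len(5,3), of e] inner_append[OF len(5,3), of e]
        outer_append[OF len(6,4), of d] inner_append[OF len(6,4), of d]
      unfolding v(1) bcd(1) append_assoc by (simp_all only: simp_thms)
    have sizes: "Suc (length (a @ (b @ d) @ e)) = n + m - 1" "Suc (length (b @ c @ d)) = m + l - 1"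
      by (simp_all add: v bcd num)
    have w: "w \<in> cliffs \<delta>" using True by (simp add: cliffs_of_size_iff)
    have subs: "subseq (a @ (b @ d) @ e) w" "subseq (b @ c @ d) w"
      by (subst words(1)[symmetric], rule subseq_outer) (subst words(4)[symmetric], rule subseq_inner)
    show ?thesis
    proof (cases "a @ e \<in> cliffs \<delta> \<and> b @ d \<in> cliffs \<delta> \<and> c \<in> cliffs \<delta>")
      case pieces: True
      have "a @ (b @ d) @ e \<in> cliffs \<delta>"
        using insertion_in_cliffs[OF assms(1) w subs(1)] pieces by blast
      moreover have "b @ c @ d \<in> cliffs \<delta>"
        using insertion_in_cliffs[OF assms(1) w subs(2)] pieces by blast
      ultimately show ?thesis
        using x y z sizes True unfolding P_def eval words ar(1) cliffs_of_size_iff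
        by (simp add: m_assoc)
    next
      case False
      then have "x (a @ e) = \<zero> \<or> y (b @ d) = \<zero> \<or> z c = \<zero>"
        using x y z by (auto simp: cliff_module_support cliffs_of_size_iff)
      then show ?thesis
        using x y z unfolding P_def eval words ar(1) by auto
    qed
  qed
qed

text \<open>At a cliff \<open>w = a @ b @ c @ d @ e\<close> the common value is the product of
  \<open>x (a @ c @ e)\<close>, \<open>y b\<close> and \<open>z d\<close>, reached through
  \<open>a @ b @ c @ e\<close> on the left and \<open>a @ c @ d @ e\<close> on the right. Non-cliff
  pieces are treated as in the sequential case.\<close>

lemma cliff_pcomp_parallel:
  assumes "unimodal \<delta>" and ij: "1 \<le> i" "i < j" "j \<le> n"
    and x: "x \<in> carrier (cliff_module R \<delta> n)" and y: "y \<in> carrier (cliff_module R \<delta> m)"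
    and z: "z \<in> carrier (cliff_module R \<delta> l)"
  defines "P \<equiv> cliff_operad R \<delta>"
  shows "pcomp P (n + m - 1) l (j + m - 1) (pcomp P n m i x y) z
    = pcomp P (n + l - 1) m i (pcomp P n l j x z) y"
proof (rule ext)
  fix w
  have ar: "n + m - 1 + l - 1 = n + l - 1 + m - 1" "1 \<le> j + m - 1" "j + m - 1 \<le> n + m - 1"
      "i \<le> n" "1 \<le> j" "i \<le> n + l - 1"
    using ij by auto
  note closed = cliff_pcomp_closed[OF ij(1) ar(4) x y] cliff_pcomp_closed[OF ar(5) ij(3) x z]
  note eval = pcomp_eval[OF ar(2,3) closed(1) z] pcomp_eval[OF ij(1) ar(6) closed(2) y]
    pcomp_eval[OF ij(1) ar(4) x y] pcomp_eval[OF ar(5) ij(3) x z]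
  show "pcomp P (n + m - 1) l (j + m - 1) (pcomp P n m i x y) z w
    = pcomp P (n + l - 1) m i (pcomp P n l j x z) y w"
  proof (cases "w \<in> cliffs_of_size \<delta> (n + m - 1 + l - 1) \<and> l \<noteq> 0 \<and> m \<noteq> 0")
    case False
    then show ?thesis
      using x y z cliff_module_support[OF z] cliff_module_support[OF y]
      unfolding P_def eval ar(1) by auto
  next
    case True
    obtain p q r l' m' where num: "i = Suc p" "j = Suc p + q" "n = Suc p + q + r"
        "l = Suc l'" "m = Suc m'"
      using ij True by (metis Suc_le_D One_nat_def le_Suc_ex not0_implies_Suc less_imp_le_nat)
    have "length w = p + m' + (q + l' + r)"
      using True by (simp add: cliffs_of_size_iff num)
    then obtain a b v where v: "w = a @ b @ v" "length a = p" "length b = m'"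
        "length v = q + l' + r"
      by (rule length_decompose3)
    obtain c d e where cde: "v = c @ d @ e" "length c = q" "length d = l'" "length e = r"
      using v(4) by (rule length_decompose3)
    have len: "length (a @ b @ c) = j + m - 1 - 1" "length b = m - 1"
      "length (a @ c) = j - 1" "length d = l - 1" "length a = i - 1"
      by (simp_all add: v cde num)
    have words: "outer (j + m - 1 - 1) (l - 1) w = a @ b @ (c @ e)"
      "inner (j + m - 1 - 1) (l - 1) w = d"
      "outer (i - 1) (m - 1) w = (a @ c) @ d @ e"
      "inner (i - 1) (m - 1) w = b"
      "outer (i - 1) (m - 1) (a @ b @ (c @ e)) = (a @ c) @ e"
      "inner (i - 1) (m - 1) (a @ b @ (c @ e)) = b"
      "outer (j - 1) (l - 1) ((a @ c) @ d @ e) = (a @ c) @ e"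
      "inner (j - 1) (l - 1) ((a @ c) @ d @ e) = d"
      using outer_append[OF len(1,4), of e] inner_append[OF len(1,4), of e]
        outer_append[OF len(5,2), of "c @ d @ e"] inner_append[OF len(5,2), of "c @ d @ e"]
        outer_append[OF len(5,2), of "c @ e"] inner_append[OF len(5,2), of "c @ e"]
        outer_append[OF len(3,4), of e] inner_append[OF len(3,4), of e]
      unfolding v(1) cde(1) append_assoc by (simp_all only: simp_thms)
    have sizes: "Suc (length (a @ b @ (c @ e))) = n + m - 1"
      "Suc (length ((a @ c) @ d @ e)) = n + l - 1"
      by (simp_all add: v cde num)
    have w: "w \<in> cliffs \<delta>" using True by (simp add: cliffs_of_size_iff)
    have subs: "subseq (a @ b @ (c @ e)) w" "subseq ((a @ c) @ d @ e) w"
      by (subst words(1)[symmetric], rule subseq_outer) (subst words(3)[symmetric], rule subseq_outer)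
    show ?thesis
    proof (cases "(a @ c) @ e \<in> cliffs \<delta> \<and> b \<in> cliffs \<delta> \<and> d \<in> cliffs \<delta>")
      case pieces: True
      have "a @ b @ (c @ e) \<in> cliffs \<delta>"
        using insertion_in_cliffs[OF assms(1) w subs(1)] pieces by simp
      moreover have "(a @ c) @ d @ e \<in> cliffs \<delta>"
        using insertion_in_cliffs[OF assms(1) w subs(2)] pieces by blast
      ultimately show ?thesis
        using x y z sizes True unfolding P_def eval words ar(1) cliffs_of_size_iff
        by (simp add: m_ac)
    next
      case False
      then have "x ((a @ c) @ e) = \<zero> \<or> y b = \<zero> \<or> z d = \<zero>"
        using cliff_module_support[OF x] cliff_module_support[OF y] cliff_module_support[OF z]
        by (auto simp: cliffs_of_size_iff)
      then show ?thesis
        using x y z unfolding P_def eval words ar(1) by auto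
    qed
  qed
qed

lemma cliff_ns_operad:
  assumes "unimodal \<delta>"
  shows "ns_operad R (cliff_operad R \<delta>)"
proof (intro ns_operad.intro ns_operad_axioms.intro, unfold cliff_operad_component)
  have unit: "ounit (cliff_operad R \<delta>) = E_basis R []"
    by (simp add: cliff_operad_def)
  have "[] \<in> cliffs_of_size \<delta> 1"
    by (simp add: cliffs_of_size_iff cliffs_iff)
  then show E: "ounit (cliff_operad R \<delta>) \<in> carrier (cliff_module R \<delta> 1)"
    unfolding unit by (rule E_basis_in_carrier)
  show "pcomp (cliff_operad R \<delta>) 1 n 1 (ounit (cliff_operad R \<delta>)) x = x"
    if x: "x \<in> carrier (cliff_module R \<delta> n)" for n x
  proof (rule ext)
    fix w
    \<comment> \<open>Cutting out all of \<open>w\<close> leaves the empty word, where the unit has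
      coefficient one.\<close>
    have "outer 0 (n - 1) w = []" "inner 0 (n - 1) w = w" if "w \<in> cliffs_of_size \<delta> n"
      using that by (auto simp: outer_def inner_def cliffs_of_size_iff)
    then show "pcomp (cliff_operad R \<delta>) 1 n 1 (ounit (cliff_operad R \<delta>)) x w = x w"
      using pcomp_eval[OF _ _ E x, of 1 w] x cliff_module_support[OF x]
      by (simp add: unit E_basis_def)
  qed
  show "pcomp (cliff_operad R \<delta>) n 1 i x (ounit (cliff_operad R \<delta>)) = x"
    if "1 \<le> i" "i \<le> n" and x: "x \<in> carrier (cliff_module R \<delta> n)" for i n x
  proof (rule ext)
    fix w
    show "pcomp (cliff_operad R \<delta>) n 1 i x (ounit (cliff_operad R \<delta>)) w = x w"
      using pcomp_eval[OF that(1,2) x E, of w] x cliff_module_support[OF x]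
      by (simp add: unit E_basis_def inner_def outer_def)
  qed
qed (rule field_axioms cliff_module_is_module cliff_pcomp_linear_left cliff_pcomp_linear_right
    cliff_pcomp_sequential[OF assms] cliff_pcomp_parallel[OF assms]; assumption)+

end

section \<open>The fundamental basis\<close>

lemma moebius_refl [simp]: "moebius \<delta> w w = 1"
  by (subst moebius.simps) simp

text \<open>This is the defining recursion of \<open>moebius\<close> with all terms on one side: the
  value at the top \<open>x\<close> cancels the sum of the others. If \<open>w\<close> is not below
  \<open>x\<close>, the interval is empty.\<close>

lemma sum_moebius:
  assumes "x \<in> cliffs \<delta>"
  shows "(\<Sum>w'\<in>{w' \<in> cliffs \<delta>. w \<preceq> w' \<and> w' \<preceq> x}. moebius \<delta> w w') = (if w = x then 1 else 0)"
proof (cases "w \<preceq> x \<and> w \<noteq> x")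
  case True
  let ?A = "{w' \<in> cliffs \<delta>. w \<preceq> w' \<and> w' \<preceq> x \<and> w' \<noteq> x}"
  have fin: "finite ?A"
    by (rule finite_subset[OF _ finite_word_le[of x]]) auto
  have "{w' \<in> cliffs \<delta>. w \<preceq> w' \<and> w' \<preceq> x} = insert x ?A"
    using True assms by auto
  moreover have "moebius \<delta> w x = - (\<Sum>w'\<in>?A. moebius \<delta> w w')"
    using True by (subst moebius.simps) simp
  ultimately show ?thesis
    using True fin by simp
next
  case False
  show ?thesis
  proof (cases "w = x")
    case True
    with assms have "{w' \<in> cliffs \<delta>. w \<preceq> w' \<and> w' \<preceq> x} = {x}"
      by (auto dest: word_le_antisym)
    with True show ?thesis by simp
  next
    case neq: False
    with False have "{w' \<in> cliffs \<delta>. w \<preceq> w' \<and> w' \<preceq> x} = {}"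
      by (auto dest: word_le_trans)
    with neq show ?thesis by (simp only: sum.empty if_False)
  qed
qed

text \<open>The coordinate of \<open>f\<close> on \<^term>\<open>F_basis K \<delta> x\<close>, as \<open>E\<^sub>w\<close> is the sum of the \<open>F\<^sub>x\<close> with
  \<open>w \<preceq> x\<close>.\<close>

definition F_coord :: "('k, 'a) ring_scheme \<Rightarrow> (nat list \<Rightarrow> 'k) \<Rightarrow> nat list \<Rightarrow> 'k" where
  "F_coord K f x = finsum K f {w. w \<preceq> x}"

section \<open>Coordinates on the fundamental basis\<close>

context field
begin

lemma add_pow_int_0: "[(0 :: int)] \<cdot> a = \<zero>"
  by (simp add: add_pow_def)

text \<open>Carries the integer identity for \<open>moebius\<close> over to the field, where the
  coefficients of \<open>F_basis\<close> live.\<close>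

lemma finsum_of_int:
  "finite A \<Longrightarrow> (\<Oplus>a\<in>A. [(f a :: int)] \<cdot> \<one>) = [(\<Sum>a\<in>A. f a)] \<cdot> \<one>"
  by (induction rule: finite_induct) (simp_all add: add.int_pow_mult add_pow_int_0)

lemma finsum_product:
  assumes "finite A" "finite B" "f \<in> A \<rightarrow> carrier R" "g \<in> B \<rightarrow> carrier R"
  shows "(\<Oplus>p\<in>A \<times> B. f (fst p) \<otimes> g (snd p)) = (\<Oplus>a\<in>A. f a) \<otimes> (\<Oplus>b\<in>B. g b)"
  using assms(1,3)
proof (induction A rule: finite_induct)
  case empty
  with assms show ?case by simp
next
  case (insert a A)
  have "insert a A \<times> B = Pair a ` B \<union> A \<times> B" by auto
  then have "(\<Oplus>p\<in>insert a A \<times> B. f (fst p) \<otimes> g (snd p))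
      = (\<Oplus>p\<in>Pair a ` B. f (fst p) \<otimes> g (snd p)) \<oplus> (\<Oplus>p\<in>A \<times> B. f (fst p) \<otimes> g (snd p))"
    using insert assms by (simp only:, intro add.finprod_Un_disjoint) (auto simp: Pi_iff)
  also have "(\<Oplus>p\<in>Pair a ` B. f (fst p) \<otimes> g (snd p)) = (\<Oplus>b\<in>B. f a \<otimes> g b)"
    using insert assms by (subst add.finprod_reindex) (auto simp: inj_on_def Pi_iff)
  also have "\<dots> = f a \<otimes> (\<Oplus>b\<in>B. g b)"
    using insert assms by (intro finsum_rdistr[symmetric]) auto
  finally show ?case
    using insert assms by (simp add: Pi_iff l_distr)
qed

lemma F_coord_add:
  "f \<in> carrier (cliff_module R \<delta> n) \<Longrightarrow> g \<in> carrier (cliff_module R \<delta> n) \<Longrightarrow>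
    F_coord R (f \<oplus>\<^bsub>cliff_module R \<delta> n\<^esub> g) x = F_coord R f x \<oplus> F_coord R g x"
  by (simp add: F_coord_def add.finprod_multf Pi_iff cliff_module_carrier_iff)

lemma F_coord_smult:
  "r \<in> carrier R \<Longrightarrow> f \<in> carrier (cliff_module R \<delta> n) \<Longrightarrow>
    F_coord R (r \<odot>\<^bsub>cliff_module R \<delta> n\<^esub> f) x = r \<otimes> F_coord R f x"
  by (simp add: F_coord_def finsum_rdistr Pi_iff cliff_module_carrier_iff)

lemma F_coord_closed:
  "f \<in> carrier (cliff_module R \<delta> n) \<Longrightarrow> F_coord R f x \<in> carrier R"
  by (auto simp: F_coord_def cliff_module_carrier_iff)

lemma F_coord_zero: "F_coord R \<zero>\<^bsub>cliff_module R \<delta> n\<^esub> x = \<zero>"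
  by (simp add: F_coord_def)

text \<open>A word and its reduction have the same cliffs below them, and all other words have
  coefficient zero.\<close>

lemma F_coord_reduction:
  assumes "f \<in> carrier (cliff_module R \<delta> n)"
  shows "F_coord R f (reduction \<delta> x) = F_coord R f x"
  unfolding F_coord_def
  using assms
  by (intro add.finprod_mono_neutral_cong_left)
    (auto simp: word_le_reduction_iff cliff_module_carrier_iff cliffs_of_size_iff)

lemma F_coord_finsum:
  assumes "finite A" "g \<in> A \<rightarrow> carrier (cliff_module R \<delta> n)"
  shows "F_coord R (finsum (cliff_module R \<delta> n) g A) x = (\<Oplus>a\<in>A. F_coord R (g a) x)"
proof -
  interpret M: module R "cliff_module R \<delta> n" by (rule cliff_module_is_module)
  show ?thesis
    using assms
  proof (induction A rule: finite_induct)
    case empty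
    show ?case by (simp add: F_coord_zero del: cliff_module_simps)
  next
    case (insert a A)
    then have "F_coord R (g b) x \<in> carrier R" if "b \<in> insert a A" for b
      using that F_coord_closed[of "g b" \<delta> n x] by blast
    with insert show ?case
      by (simp add: F_coord_add[of _ \<delta> n] Pi_iff del: cliff_module_simps)
  qed
qed

text \<open>The passage from coefficients to coordinates is unitriangular: the coordinate at
  \<open>x\<close> is the coefficient at \<open>x\<close> plus those at strictly smaller words,
  which have a smaller sum of letters. Induction on that sum recovers the coefficients.\<close>

lemma F_coord_inject:
  assumes f: "f \<in> carrier (cliff_module R \<delta> n)" and g: "g \<in> carrier (cliff_module R \<delta> n)"
    and eq: "\<And>x. x \<in> cliffs_of_size \<delta> n \<Longrightarrow> F_coord R f x = F_coord R g x"
  shows "f = g"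
proof (rule ext)
  have split: "F_coord R h x = h x \<oplus> (\<Oplus>w\<in>{w. w \<preceq> x} - {x}. h w)"
    if h: "h \<in> carrier (cliff_module R \<delta> n)" for h x
  proof -
    have "{w. w \<preceq> x} = insert x ({w. w \<preceq> x} - {x})" by auto
    then have "F_coord R h x = (\<Oplus>w\<in>insert x ({w. w \<preceq> x} - {x}). h w)"
      by (simp only: F_coord_def)
    also have "\<dots> = h x \<oplus> (\<Oplus>w\<in>{w. w \<preceq> x} - {x}. h w)"
      using h by (intro add.finprod_insert) (auto simp: cliff_module_carrier_iff)
    finally show ?thesis .
  qed
  fix x
  show "f x = g x"
  proof (induction "sum_list x" arbitrary: x rule: less_induct)
    case less
    show ?case
    proof (cases "x \<in> cliffs_of_size \<delta> n")
      case True
      have "(\<Oplus>w\<in>{w. w \<preceq> x} - {x}. f w) = (\<Oplus>w\<in>{w. w \<preceq> x} - {x}. g w)"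
        using g less word_le_sum_list
        by (intro add.finprod_cong') (auto simp: cliff_module_carrier_iff)
      moreover have "(\<Oplus>w\<in>{w. w \<preceq> x} - {x}. g w) \<in> carrier R"
        using g by (auto simp: cliff_module_carrier_iff)
      ultimately show ?thesis
        using eq[OF True] split[OF f, of x] split[OF g, of x] f g
          cliff_module_closed[OF f, of x] cliff_module_closed[OF g, of x]
        by (metis add.r_cancel)
    next
      case False
      with f g show ?thesis by (simp add: cliff_module_support)
    qed
  qed
qed

lemma F_basis_eval:
  assumes "w \<in> cliffs_of_size \<delta> n"
  shows "F_basis R \<delta> w \<in> carrier (cliff_module R \<delta> n)"
    and "F_basis R \<delta> w x = (if x \<in> cliffs \<delta> \<and> w \<preceq> x then [moebius \<delta> w x] \<cdot> \<one> else \<zero>)"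
proof -
  let ?M = "cliff_module R \<delta> n"
  let ?A = "{w' \<in> cliffs \<delta>. w \<preceq> w'}"
  let ?t = "\<lambda>w'. ([moebius \<delta> w w'] \<cdot> \<one>) \<odot>\<^bsub>?M\<^esub> E_basis R w'"
  interpret M: module R ?M by (rule cliff_module_is_module)
  have sub: "?A \<subseteq> cliffs_of_size \<delta> n"
    using assms by (auto simp: cliffs_of_size_iff word_le_iff)
  have F: "F_basis R \<delta> w = finsum ?M ?t ?A"
    using assms by (simp add: F_basis_def cliffs_of_size_def)
  have t: "?t \<in> ?A \<rightarrow> carrier ?M"
    using sub by (intro funcsetI M.smult_closed E_basis_in_carrier) auto
  show "F_basis R \<delta> w \<in> carrier ?M"
    unfolding F by (rule M.add.finprod_closed[OF t])
  have ev: "F_basis R \<delta> w x = (\<Oplus>w'\<in>?A. ?t w' x)"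
    unfolding F by (rule finsum_cliff_module[OF t])
  show "F_basis R \<delta> w x = (if x \<in> cliffs \<delta> \<and> w \<preceq> x then [moebius \<delta> w x] \<cdot> \<one> else \<zero>)"
  proof (cases "x \<in> ?A")
    case True
    have "(\<Oplus>w'\<in>?A. ?t w' x) = ?t x x"
      by (rule finsum_eq_single[OF finite_subset[OF sub]]) (use True in \<open>auto simp: E_basis_def\<close>)
    with True ev show ?thesis by (simp add: E_basis_def)
  next
    case False
    have "(\<Oplus>w'\<in>?A. ?t w' x) = \<zero>"
      by (rule finsum_eq_zero) (use False in \<open>auto simp: E_basis_def\<close>)
    with False ev show ?thesis by auto
  qed
qed

text \<open>Duality by Moebius inversion: the coefficients of \<open>F_basis R \<delta> w\<close>
  below \<open>x\<close> are the values of \<open>moebius\<close> on the interval from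
  \<open>w\<close> to \<open>x\<close>.\<close>

lemma F_coord_F_basis:
  assumes w: "w \<in> cliffs_of_size \<delta> n" and x: "x \<in> cliffs \<delta>"
  shows "F_coord R (F_basis R \<delta> w) x = (if w = x then \<one> else \<zero>)"
proof -
  let ?A = "{w' \<in> cliffs \<delta>. w \<preceq> w' \<and> w' \<preceq> x}"
  have fin: "finite ?A"
    by (rule finite_subset[OF _ finite_word_le[of x]]) auto
  have "F_coord R (F_basis R \<delta> w) x = (\<Oplus>w'\<in>?A. [moebius \<delta> w w'] \<cdot> \<one>)"
    unfolding F_coord_def
    by (rule add.finprod_mono_neutral_cong_right)
      (use x in \<open>auto simp: F_basis_eval(2)[OF w] dest: word_le_cliff\<close>)
  also have "\<dots> = [(\<Sum>w'\<in>?A. moebius \<delta> w w')] \<cdot> \<one>"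
    by (rule finsum_of_int[OF fin])
  also have "\<dots> = (if w = x then \<one> else \<zero>)"
    by (simp add: sum_moebius[OF x] add_pow_int_0)
  finally show ?thesis .
qed

text \<open>\<open>lin_span\<close> attaches scalars to vectors, whereas coordinates are indexed by
  cliffs; injectivity translates one into the other.\<close>

lemma F_basis_inj: "inj_on (F_basis R \<delta>) (cliffs_of_size \<delta> n)"
proof (rule inj_onI)
  fix v w assume "v \<in> cliffs_of_size \<delta> n" "w \<in> cliffs_of_size \<delta> n" "F_basis R \<delta> v = F_basis R \<delta> w"
  then show "v = w"
    using F_coord_F_basis[of v \<delta> n w] F_coord_F_basis[of w \<delta> n w]
    by (auto simp: cliffs_of_size_iff split: if_splits)
qed

text \<open>By duality both sides have the same coordinates, so \<open>F_coord_inject\<close>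
  applies. The set \<open>A\<close> will be the set of cliffs outside \<open>S\<close>.\<close>

lemma F_expansion:
  assumes f: "f \<in> carrier (cliff_module R \<delta> n)"
    and zero: "\<And>x. x \<in> cliffs_of_size \<delta> n - A \<Longrightarrow> F_coord R f x = \<zero>"
    and A: "A \<subseteq> cliffs_of_size \<delta> n"
  shows "f = finsum (cliff_module R \<delta> n)
    (\<lambda>w. F_coord R f w \<odot>\<^bsub>cliff_module R \<delta> n\<^esub> F_basis R \<delta> w) A"
proof (rule F_coord_inject[OF f])
  let ?M = "cliff_module R \<delta> n"
  let ?t = "\<lambda>w. F_coord R f w \<odot>\<^bsub>?M\<^esub> F_basis R \<delta> w"
  interpret M: module R ?M by (rule cliff_module_is_module)
  have fin: "finite A" using A by (rule finite_subset) simp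
  have t: "?t \<in> A \<rightarrow> carrier ?M"
    using A by (intro funcsetI M.smult_closed F_coord_closed[OF f] F_basis_eval(1)) auto
  show "finsum ?M ?t A \<in> carrier ?M"
    by (rule M.add.finprod_closed[OF t])
  fix x assume x: "x \<in> cliffs_of_size \<delta> n"
  have ev: "F_coord R (?t w) x = (if w = x then F_coord R f x else \<zero>)" if "w \<in> A" for w
  proof -
    have w: "w \<in> cliffs_of_size \<delta> n" using A that by blast
    have "F_coord R (?t w) x = F_coord R f w \<otimes> F_coord R (F_basis R \<delta> w) x"
      by (rule F_coord_smult[OF F_coord_closed[OF f] F_basis_eval(1)[OF w]])
    with x F_coord_closed[OF f] show ?thesis
      by (simp add: F_coord_F_basis[OF w] cliffs_of_size_iff)
  qed
  have "F_coord R (finsum ?M ?t A) x = (\<Oplus>w\<in>A. F_coord R (?t w) x)"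
    by (rule F_coord_finsum[OF fin t])
  also have "\<dots> = F_coord R f x"
  proof (cases "x \<in> A")
    case True
    then have "(\<Oplus>w\<in>A. F_coord R (?t w) x) = F_coord R (?t x) x"
      using ev F_coord_closed[OF f] fin
      by (intro finsum_eq_single) (simp_all del: cliff_module_simps)
    with True ev show ?thesis by (simp del: cliff_module_simps)
  next
    case False
    then have "(\<Oplus>w\<in>A. F_coord R (?t w) x) = \<zero>"
      using ev by (intro finsum_eq_zero) (auto simp del: cliff_module_simps)
    with False x zero show ?thesis by simp
  qed
  finally show "F_coord R f x = F_coord R (finsum ?M ?t A) x" by simp
qed

text \<open>Presents the span as a common kernel of coordinates, so that closure under the
  operations becomes a vanishing statement. One inclusion is duality, the other the expansion on the
  fundamental basis.\<close>

lemma V_space_iff: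
  "f \<in> V_space R \<delta> S n \<longleftrightarrow>
    f \<in> carrier (cliff_module R \<delta> n) \<and> (\<forall>x\<in>cliffs_of_size \<delta> n \<inter> S. F_coord R f x = \<zero>)"
proof -
  let ?M = "cliff_module R \<delta> n"
  let ?C = "cliffs_of_size \<delta> n - S"
  interpret M: module R ?M by (rule cliff_module_is_module)
  show ?thesis
  proof (intro iffI conjI ballI)
    assume "f \<in> V_space R \<delta> S n"
    then obtain a A where A: "finite A" "A \<subseteq> F_basis R \<delta> ` ?C" "a \<in> A \<rightarrow> carrier R"
      and f: "f = finsum ?M (\<lambda>y. a y \<odot>\<^bsub>?M\<^esub> y) A"
      unfolding V_space_def lin_span_def by blast
    have carr: "y \<in> carrier ?M" if "y \<in> A" for y
      using that A(2) F_basis_eval(1)[of _ \<delta> n] by blast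
    then have t: "(\<lambda>y. a y \<odot>\<^bsub>?M\<^esub> y) \<in> A \<rightarrow> carrier ?M"
      using A(3) by (intro funcsetI M.smult_closed) auto
    show "f \<in> carrier ?M"
      unfolding f by (rule M.add.finprod_closed[OF t])
    fix x assume x: "x \<in> cliffs_of_size \<delta> n \<inter> S"
    have "F_coord R (a y \<odot>\<^bsub>?M\<^esub> y) x = \<zero>" if y: "y \<in> A" for y
    proof -
      obtain w where w: "y = F_basis R \<delta> w" "w \<in> ?C" using A(2) y by blast
      have "F_coord R (a y \<odot>\<^bsub>?M\<^esub> y) x = a y \<otimes> F_coord R y x"
        using A(3) y carr by (intro F_coord_smult) auto
      also have "F_coord R y x = \<zero>"
        using w x F_coord_F_basis[of w \<delta> n x] by (auto simp: cliffs_of_size_iff)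
      also have "a y \<otimes> \<zero> = \<zero>"
        using A(3) y by (intro r_null) auto
      finally show ?thesis .
    qed
    then show "F_coord R f x = \<zero>"
      unfolding f F_coord_finsum[OF A(1) t] by (rule finsum_eq_zero)
  next
    assume "f \<in> carrier ?M \<and> (\<forall>x\<in>cliffs_of_size \<delta> n \<inter> S. F_coord R f x = \<zero>)"
    then have f: "f \<in> carrier ?M" and zero: "\<And>x. x \<in> cliffs_of_size \<delta> n \<inter> S \<Longrightarrow> F_coord R f x = \<zero>"
      by auto
    \<comment> \<open>The coordinates of \<open>f\<close>, reindexed by the basis vectors themselves
      as \<open>lin_span\<close> demands.\<close>
    define a where "a = (\<lambda>y. F_coord R f (the_inv_into ?C (F_basis R \<delta>) y))"
    have inj: "inj_on (F_basis R \<delta>) ?C"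
      by (rule inj_on_subset[OF F_basis_inj]) auto
    have a: "a (F_basis R \<delta> w) = F_coord R f w" if "w \<in> ?C" for w
      using that by (simp add: a_def the_inv_into_f_f[OF inj])
    have a_closed: "a \<in> F_basis R \<delta> ` ?C \<rightarrow> carrier R"
      using F_coord_closed[OF f] by (simp add: a_def)
    have "f = finsum ?M (\<lambda>w. F_coord R f w \<odot>\<^bsub>?M\<^esub> F_basis R \<delta> w) ?C"
      by (rule F_expansion[OF f]) (use zero in auto)
    also have "\<dots> = finsum ?M (\<lambda>w. a (F_basis R \<delta> w) \<odot>\<^bsub>?M\<^esub> F_basis R \<delta> w) ?C"
      using a F_coord_closed[OF f] F_basis_eval(1)
      by (intro M.add.finprod_cong') (auto simp del: cliff_module_simps)
    also have "\<dots> = finsum ?M (\<lambda>y. a y \<odot>\<^bsub>?M\<^esub> y) (F_basis R \<delta> ` ?C)"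
    proof (intro M.add.finprod_reindex[symmetric] inj funcsetI)
      fix y assume y: "y \<in> F_basis R \<delta> ` ?C"
      then have "y \<in> carrier ?M"
        using F_basis_eval(1)[of _ \<delta> n] by blast
      with y show "a y \<odot>\<^bsub>?M\<^esub> y \<in> carrier ?M"
        using a_closed by (intro M.smult_closed) auto
    qed
    finally show "f \<in> V_space R \<delta> S n"
      unfolding V_space_def lin_span_def mem_Collect_eq
      using a_closed by (intro exI[of _ a] exI[of _ "F_basis R \<delta> ` ?C"]) simp
  qed
qed

lemma V_space_submodule: "submodule (V_space R \<delta> S n) R (cliff_module R \<delta> n)"
proof -
  let ?M = "cliff_module R \<delta> n"
  interpret M: module R ?M by (rule cliff_module_is_module)
  have smult: "r \<odot>\<^bsub>?M\<^esub> f \<in> V_space R \<delta> S n" if "r \<in> carrier R" "f \<in> V_space R \<delta> S n" for r f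
    using that by (auto simp: V_space_iff F_coord_smult simp del: cliff_module_simps)
  show ?thesis
  proof (rule M.submoduleI)
    fix f assume f: "f \<in> V_space R \<delta> S n"
    then have "\<ominus>\<^bsub>?M\<^esub> f = (\<ominus> \<one>) \<odot>\<^bsub>?M\<^esub> f"
      by (simp add: V_space_iff M.smult_l_minus del: cliff_module_simps)
    with f smult show "\<ominus>\<^bsub>?M\<^esub> f \<in> V_space R \<delta> S n" by simp
    show "r \<odot>\<^bsub>?M\<^esub> f \<in> V_space R \<delta> S n" if "r \<in> carrier R" "f \<in> V_space R \<delta> S n" for r f
      using that by (rule smult)
  qed (auto simp: V_space_iff F_coord_add F_coord_zero simp del: cliff_module_simps)
qed

text \<open>The order is letterwise, so insertion is a bijection from pairs of words below the two
  pieces of \<open>x\<close> onto the words below \<open>x\<close>. Along it the sum of the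
  coefficients factors. The pieces need not be cliffs.\<close>

lemma F_coord_pcomp:
  assumes i: "1 \<le> i" "i \<le> n" and m: "1 \<le> m"
    and f: "f \<in> carrier (cliff_module R \<delta> n)" and g: "g \<in> carrier (cliff_module R \<delta> m)"
    and x: "x \<in> cliffs_of_size \<delta> (n + m - 1)"
  shows "F_coord R (pcomp (cliff_operad R \<delta>) n m i f g) x =
    F_coord R f (outer (i - 1) (m - 1) x) \<otimes> F_coord R g (inner (i - 1) (m - 1) x)"
proof -
  have "length x = (i - 1) + (m - 1) + (n - i)"
    using x i m by (auto simp: cliffs_of_size_iff)
  then obtain a y b where d: "x = a @ y @ b" "length a = i - 1" "length y = m - 1" "length b = n - i"
    by (rule length_decompose3)
  let ?U = "{u. u \<preceq> a @ b}" and ?V = "{v. v \<preceq> y}"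
  let ?h = "\<lambda>(u, v). insert_word u i v"
  have split: "outer (i - 1) (m - 1) (?h p) = fst p" "inner (i - 1) (m - 1) (?h p) = snd p"
    if "p \<in> ?U \<times> ?V" for p
  proof -
    have "length (fst p) = n - 1" "length (snd p) = m - 1"
      using that d i by (auto simp: word_le_iff)
    then show "outer (i - 1) (m - 1) (?h p) = fst p" "inner (i - 1) (m - 1) (?h p) = snd p"
      using i by (auto simp: case_prod_unfold insert_word_def outer_def inner_def)
  qed
  have inj: "inj_on ?h (?U \<times> ?V)"
    by (rule inj_onI) (metis split prod_eqI)
  have img: "?h ` (?U \<times> ?V) = {w. w \<preceq> x}"
  proof (intro equalityI subsetI)
    fix w assume "w \<in> ?h ` (?U \<times> ?V)"
    then obtain u v where uv: "u \<preceq> a @ b" "v \<preceq> y" and w: "w = insert_word u i v" by auto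
    have len: "length (take (i - 1) u) = length a"
      using uv(1) d by (auto simp: word_le_iff)
    have "take (i - 1) u @ drop (i - 1) u \<preceq> a @ b" using uv(1) by simp
    then have "take (i - 1) u \<preceq> a" "drop (i - 1) u \<preceq> b"
      by (simp_all only: word_le_append[OF len])
    then show "w \<in> {w. w \<preceq> x}"
      using uv(2) len by (simp add: w d(1) insert_word_def word_le_append word_le_iff[of v])
  next
    fix w assume "w \<in> {w. w \<preceq> x}"
    then have w: "w \<preceq> a @ y @ b" by (simp add: d)
    then have "length w = length a + length y + length b" by (simp add: word_le_iff)
    then obtain a' y' b' where w': "w = a' @ y' @ b'" "length a' = length a" "length y' = length y"
      "length b' = length b"
      by (rule length_decompose3)
    then have "a' \<preceq> a" "y' \<preceq> y" "b' \<preceq> b"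
      using w by (simp_all add: word_le_append)
    with w' d show "w \<in> ?h ` (?U \<times> ?V)"
      by (intro image_eqI[of _ _ "(a' @ b', y')"]) (simp_all add: insert_word_append word_le_append)
  qed
  have "F_coord R (pcomp (cliff_operad R \<delta>) n m i f g) x =
      (\<Oplus>w\<in>?h ` (?U \<times> ?V). pcomp (cliff_operad R \<delta>) n m i f g w)"
    by (simp add: F_coord_def img)
  also have "\<dots> = (\<Oplus>p\<in>?U \<times> ?V. pcomp (cliff_operad R \<delta>) n m i f g (?h p))"
    using f g by (intro add.finprod_reindex inj) (auto simp: pcomp_eval[OF i f g])
  also have "\<dots> = (\<Oplus>p\<in>?U \<times> ?V. f (fst p) \<otimes> g (snd p))"
  proof (rule add.finprod_cong')
    show "(\<lambda>p. f (fst p) \<otimes> g (snd p)) \<in> ?U \<times> ?V \<rightarrow> carrier R"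
      using f g by auto
    fix p assume p: "p \<in> ?U \<times> ?V"
    \<comment> \<open>Below the cliff \<open>x\<close> every insertion is a cliff, so no term is
      lost to the zero case of the composition.\<close>
    then have "?h p \<preceq> x" using img by blast
    then have "?h p \<in> cliffs_of_size \<delta> (n + m - 1)"
      using x word_le_cliff[of "?h p" x] by (auto simp: cliffs_of_size_iff word_le_iff)
    with p show "pcomp (cliff_operad R \<delta>) n m i f g (?h p) = f (fst p) \<otimes> g (snd p)"
      by (simp only: pcomp_eval[OF i f g] split if_True)
  qed simp
  also have "\<dots> = F_coord R f (a @ b) \<otimes> F_coord R g y"
    unfolding F_coord_def using f g by (intro finsum_product) auto
  finally show ?thesis
    using d by (simp add: outer_append inner_append)
qed

lemma cliff_operad_ideal:
  assumes "unimodal \<delta>" and S: "closed_by_subword_reduction \<delta> S"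
  shows "operad_ideal R (cliff_operad R \<delta>) (V_space R \<delta> S)"
proof -
  have sub: "outer (i - 1) (m - 1) x \<in> {y. reduction \<delta> y \<in> cliffs_of_size \<delta> n \<inter> S}"
    "inner (i - 1) (m - 1) x \<in> {y. reduction \<delta> y \<in> cliffs_of_size \<delta> m \<inter> S}"
    if "x \<in> cliffs_of_size \<delta> (n + m - 1) \<inter> S" "1 \<le> i" "i \<le> n" "1 \<le> m" for x i n m
  proof -
    have "reduction \<delta> (outer (i - 1) (m - 1) x) \<in> S" "reduction \<delta> (inner (i - 1) (m - 1) x) \<in> S"
      using S that subseq_inner subseq_outer unfolding closed_by_subword_reduction_def by blast+
    moreover have "length (outer (i - 1) (m - 1) x) = n - 1" "length (inner (i - 1) (m - 1) x) = m - 1"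
      using that by (auto simp: outer_def inner_def cliffs_of_size_iff)
    ultimately show "outer (i - 1) (m - 1) x \<in> {y. reduction \<delta> y \<in> cliffs_of_size \<delta> n \<inter> S}"
      "inner (i - 1) (m - 1) x \<in> {y. reduction \<delta> y \<in> cliffs_of_size \<delta> m \<inter> S}"
      using that by (auto simp: cliffs_of_size_iff reduction_in_cliffs)
  qed
  have vanish: "F_coord R f y = \<zero>"
    if "f \<in> V_space R \<delta> S n" "reduction \<delta> y \<in> cliffs_of_size \<delta> n \<inter> S" for f y n
    using that F_coord_reduction[of f \<delta> n y] by (auto simp: V_space_iff)
  \<comment> \<open>Both ideal conditions at once: the product formula vanishes as soon as either
    factor does.\<close>
  have comp: "pcomp (cliff_operad R \<delta>) n m i f g \<in> V_space R \<delta> S (n + m - 1)"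
    if i: "1 \<le> i" "i \<le> n" and f: "f \<in> carrier (cliff_module R \<delta> n)"
      and g: "g \<in> carrier (cliff_module R \<delta> m)"
      and V: "f \<in> V_space R \<delta> S n \<or> g \<in> V_space R \<delta> S m" for n m i f g
  proof -
    have "F_coord R (pcomp (cliff_operad R \<delta>) n m i f g) x = \<zero>"
      if x: "x \<in> cliffs_of_size \<delta> (n + m - 1) \<inter> S" for x
    \<comment> \<open>The product formula requires \<open>m\<close> positive; for
      \<open>m = 0\<close> the element \<open>g\<close>, and with it the composite, is zero.\<close>
    proof (cases "m = 0")
      case True
      have "pcomp (cliff_operad R \<delta>) n m i f g w = \<zero>" for w
        using pcomp_eval[OF i f g, of w] f cliff_module_support[OF g] True by auto
      then show ?thesis unfolding F_coord_def by (rule finsum_eq_zero)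
    next
      case False
      then have m: "1 \<le> m" by simp
      have "F_coord R f (outer (i - 1) (m - 1) x) = \<zero> \<or> F_coord R g (inner (i - 1) (m - 1) x) = \<zero>"
        using V vanish sub[OF x i m] by blast
      then show ?thesis
        using x F_coord_closed[OF f] F_coord_closed[OF g]
        by (auto simp: F_coord_pcomp[OF i m f g])
    qed
    with cliff_pcomp_closed[OF i f g] show ?thesis
      by (simp add: V_space_iff)
  qed
  show ?thesis
  proof (intro operad_ideal.intro operad_ideal_axioms.intro cliff_ns_operad assms(1),
      unfold cliff_operad_component)
    show "submodule (V_space R \<delta> S n) R (cliff_module R \<delta> n)" for n
      by (rule V_space_submodule)
    fix i n m :: nat and f g
    assume i: "1 \<le> i" "i \<le> n"
    show "pcomp (cliff_operad R \<delta>) n m i f g \<in> V_space R \<delta> S (n + m - 1)"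
      if "f \<in> V_space R \<delta> S n" "g \<in> carrier (cliff_module R \<delta> m)"
      using comp[OF i] that V_space_iff by blast
    show "pcomp (cliff_operad R \<delta>) n m i f g \<in> V_space R \<delta> S (n + m - 1)"
      if "f \<in> carrier (cliff_module R \<delta> n)" "g \<in> V_space R \<delta> S m"
      using comp[OF i] that V_space_iff by blast
  qed
qed

end

theorem proposition3p1p1:
  fixes K :: "('k, 'a) ring_scheme" and \<delta> :: "nat \<Rightarrow> nat" and S :: "nat list set"
  assumes "field K"
    and char_zero: "\<And>n::nat. 0 < n \<Longrightarrow> [n] \<cdot>\<^bsub>K\<^esub> \<one>\<^bsub>K\<^esub> \<noteq> \<zero>\<^bsub>K\<^esub>"
    and "unimodal \<delta>"
    and "S \<subseteq> cliffs \<delta>" and "S \<noteq> {}"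
    and "closed_by_subword_reduction \<delta> S"
  shows "operad_ideal K (cliff_operad K \<delta>) (V_space K \<delta> S) \<and>
    ns_operad K (quotient_operad (cliff_operad K \<delta>) (V_space K \<delta> S)) \<and>
    operad_hom K (cliff_operad K \<delta>) (quotient_operad (cliff_operad K \<delta>) (V_space K \<delta> S))
      (\<lambda>n x. V_space K \<delta> S n +>\<^bsub>component (cliff_operad K \<delta>) n\<^esub> x) \<and>
    (\<forall>n. (\<lambda>x. V_space K \<delta> S n +>\<^bsub>component (cliff_operad K \<delta>) n\<^esub> x)
           ` carrier (component (cliff_operad K \<delta>) n)
         = carrier (component (quotient_operad (cliff_operad K \<delta>) (V_space K \<delta> S)) n))"
proof -
  \<comment> \<open>The remaining conjuncts hold for every operad ideal.\<close>
  interpret operad_ideal K "cliff_operad K \<delta>" "V_space K \<delta> S"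
    by (rule field.cliff_operad_ideal) fact+
  show ?thesis
    using operad_ideal_axioms quotient_ns_operad quotient_operad_hom coset_onto by blast
qed

end
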